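(* Let $G$ be a group and let $X$ be a uniform bornological coarse space with an action of $G$ by automorphisms. Assume: 1. $G$ is countable. 2. The $G$-action on $X$ is uniformly free. 3. The uniform structure of $X$ admits a uniform scale, the underlying bornological coarse space of $X$ is a $G$-bornological coarse space, and the $G$-action on $X$ is Lipschitz. Then there exists a cofinal set of coarse entourages $V$ of $\mathcal{O}^\infty(X)$ such that $G$ acts on $\mathcal{O}^\infty(X)_V$ and the map $$f:(G\ltimes\mathcal{O}^\infty(X)_V)//G\to\mathcal{O}^\infty(X)_V//G,\qquad(g,n,x)\mapsto(n,g^{-1}x)$$ is a branched coarse $G$-covering with respect to the big family $((-\infty,n]\times X)_{n\in\mathbb{N}}$.
   Context: **Spaces.** Entourages are subsets of $X\times X$; $U^l$ denotes the $l$-fold composition, $gU:=(g\times g)(U)$, $U[B]:=\{x\mid\exists b\in B:(x,b)\in U\}$. A bornological coarse space is a set with a bornology (bounded subsets: closed under subsets and finite unions, covering the set) and a coarse structure (entourages: containing the diagonal, closed under subsets, finite unions, inverses, compositions) such that $U[B]$ is bounded for $U$ coarse, $B$ bounded. A map is controlled if it sends coarse entourages to coarse entourages, and proper if preimages of bounded sets are bounded. A uniform bornological coarse space has in addition a uniform structure such that some coarse entourage is also uniform; its automorphisms are uniform, proper and controlled in both directions. A $G$-bornological coarse space is a bornological coarse space with $G$-action by automorphisms such that every coarse entourage is contained in a $G$-invariant one. A big family is a filtered increasing family $(Z_i)$ of subsets such that for all $i$ and coarse $U$ there is $j$ with $U[Z_i]\subseteq Z_j$. $X_U$ denotes $X$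 with coarse structure generated by the single entourage $U$. **Cone.** $\mathrm{Sq}(X)$ is the set $\mathbb{Z}\times X$ with bornology generated by $F\times B$ ($F$ finite, $B$ bounded) and coarse structure consisting of all subsets of entourages $(\mathrm{diag}(\mathbb{Z})\times U)\cap W$, where $U$ is coarse on $X$ and $W$ is such that for every uniform entourage $V'$ of $X$ there is $n_0$ with $W\cap(\{n\}\times X)^2\subseteq V'$ for all $n\ge n_0$. $\mathcal{O}^\infty(X)$ is $\mathrm{Sq}(X)$ with coarse structure enlarged by the entourage $\{((n+1,x),(n,x))\mid n\in\mathbb{Z},x\in X\}$ (i.e. $\mathrm{Sq}(X)//\mathbb{Z}$ for the shift action). $G$ acts by $g(n,x)=(n,gx)$. **Conditions.** The action on $X$ is uniformly free if for every $g\ne e$ there is a uniform entourage $U$ of $X$ with $U\cap\{(gx,x)\mid x\in X\}=\emptyset$. A uniform scale on $X$ is a family $(U_n)_{n\in\mathbb{N}}$ of uniform entourages cofinal in the uniform structure (every uniform entourage contains $U_n$ for all sufficiently large $n$). It is dominated by $(V_n)$ if $U_n\subseteq V_n$ for all $n$. A uniform scale $(V_n)$ is a Lipschitz scale if for every $g\in G$ there is $k\in\mathbb{N}$ with $gV_n^l\subseteq V_n^{lk}$ for all $n,l\in\mathbb{N}$. The $G$-action is Lipschitz if every uniform scale on $X$ is dominated by a Lipschitz scale. **Quotient and $G\ltimes-$.** For a bornological coarse space $Y$ with $G$-action by automorphisms, $Y//G$ is $Y$ with the same bornology and the coarse structure generated by that of $Y$ and the entourages $\{(gy,y)\mid y\in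 Y\}$, $g\in G$. $G\ltimes Y$ is the set $G\times Y$ with the diagonal $G$-action (left multiplication on $G$), coarse structure generated by the entourages $W_G:=(f\times f)^{-1}(W)\cap(\mathrm{pr}_G\times\mathrm{pr}_G)^{-1}(\mathrm{diag}(G))$ for all coarse entourages $W$ of $Y$, where $f(g,y)=g^{-1}y$, and bornology generated by $F\times B$ ($F\subseteq G$ finite, $B$ bounded). It has an additional commuting $G$-action by right multiplication on the factor $G$ (such that $f$ intertwines it with the action on $Y$); $(G\ltimes Y)//G$ is the quotient with respect to this additional action and is a $G$-bornological coarse space via the diagonal action. $Y//G$ carries the trivial $G$-action. **Branched coarse $G$-covering.** Let $A$ be a $G$-bornological coarse space, $B$ a bornological coarse space with big family $\mathcal{Z}$ and trivial $G$-action, $f:A\to B$ a $G$-equivariant map of sets. $f$ is a branched coarse $G$-covering with respect to $\mathcal{Z}$ if $f$ is controlled, bornological (bounded sets have bounded images), has locally finite fibres (fibres meet bounded sets in finite sets), and there is a $G$-invariant entourage $P$ on $A$ such that: (1) for every coarse entourage $V$ of $B$ there is $Z\in\mathcal{Z}$ such that for every $(b',b)\in V\cap(B\times(B\setminus Z))$ and $a\in f^{-1}(b)$ there is a unique $a'\in f^{-1}(b')$ with $(a',a)\in P$, and $P\cap(f\times f)^{-1}(V\cap(B\times(B\setminus Z)))$ is a coarse entourage of $A$; (2) for every coarse entourage $U$ of $A$ there is $Z\in\mathcal{Z}$ with $U\cap(A\times f^{-1}(B\setminus Z))\subseteq P$. *)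

theory Defs
  imports "HOL.Hull" "HOL-Algebra.Group_Action" "HOL-Library.Countable_Set"
begin

section \<open>Bornological coarse spaces\<close>

text \<open>
  Entourages are relations; \<^term>\<open>U O V\<close> is their composition, \<^term>\<open>U ^^ l\<close> the
  \<^term>\<open>l\<close>-fold composition, and \<^term>\<open>map_prod f f ` U\<close> is the image (f \<times> f)(U).
\<close>

definition bornology :: "'a set \<Rightarrow> 'a set set \<Rightarrow> bool" where
  "bornology X \<B> \<longleftrightarrow>
     {} \<in> \<B> \<and> \<Union>\<B> = X \<and>
     (\<forall>A B. A \<in> \<B> \<and> B \<subseteq> A \<longrightarrow> B \<in> \<B>) \<and>
     (\<forall>A B. A \<in> \<B> \<and> B \<in> \<B> \<longrightarrow> A \<union> B \<in> \<B>)"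

definition coarse_structure :: "'a set \<Rightarrow> ('a \<times> 'a) set set \<Rightarrow> bool" where
  "coarse_structure X \<C> \<longleftrightarrow>
     \<C> \<subseteq> Pow (X \<times> X) \<and> Id_on X \<in> \<C> \<and>
     (\<forall>U V. U \<in> \<C> \<and> V \<subseteq> U \<longrightarrow> V \<in> \<C>) \<and>
     (\<forall>U V. U \<in> \<C> \<and> V \<in> \<C> \<longrightarrow> U \<union> V \<in> \<C>) \<and>
     (\<forall>U. U \<in> \<C> \<longrightarrow> U\<inverse> \<in> \<C>) \<and>
     (\<forall>U V. U \<in> \<C> \<and> V \<in> \<C> \<longrightarrow> U O V \<in> \<C>)"

definition uniform_structure :: "'a set \<Rightarrow> ('a \<times> 'a) set set \<Rightarrow> bool" where
  "uniform_structure X \<U> \<longleftrightarrow>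
     \<U> \<subseteq> Pow (X \<times> X) \<and> X \<times> X \<in> \<U> \<and>
     (\<forall>U\<in>\<U>. Id_on X \<subseteq> U) \<and>
     (\<forall>U V. U \<in> \<U> \<and> U \<subseteq> V \<and> V \<subseteq> X \<times> X \<longrightarrow> V \<in> \<U>) \<and>
     (\<forall>U V. U \<in> \<U> \<and> V \<in> \<U> \<longrightarrow> U \<inter> V \<in> \<U>) \<and>
     (\<forall>U. U \<in> \<U> \<longrightarrow> U\<inverse> \<in> \<U>) \<and>
     (\<forall>U\<in>\<U>. \<exists>V\<in>\<U>. V O V \<subseteq> U)"

text \<open>Pairs are read from right to left, so this is the image under the converse relation.\<close>

definition thickening :: "('a \<times> 'a) set \<Rightarrow> 'a set \<Rightarrow> 'a set" where
  "thickening U B = {x. \<exists>b\<in>B. (x, b) \<in> U}"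

record 'a bc_space = "'a partial_object" +
  bounded_sets :: "'a set set"
  coarse_ents :: "('a \<times> 'a) set set"

record 'a ubc_space = "'a bc_space" +
  uniform_ents :: "('a \<times> 'a) set set"

definition bornological_coarse_space :: "('a, 'm) bc_space_scheme \<Rightarrow> bool" where
  "bornological_coarse_space X \<longleftrightarrow>
     bornology (carrier X) (bounded_sets X) \<and>
     coarse_structure (carrier X) (coarse_ents X) \<and>
     (\<forall>U\<in>coarse_ents X. \<forall>B\<in>bounded_sets X. thickening U B \<in> bounded_sets X)"

definition uniform_bornological_coarse_space :: "('a, 'm) ubc_space_scheme \<Rightarrow> bool" where
  "uniform_bornological_coarse_space X \<longleftrightarrow>
     bornological_coarse_space X \<and>
     uniform_structure (carrier X) (uniform_ents X) \<and>
     coarse_ents X \<inter> uniform_ents X \<noteq> {}"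

definition controlled ::
  "('a, 'm) bc_space_scheme \<Rightarrow> ('b, 'n) bc_space_scheme \<Rightarrow> ('a \<Rightarrow> 'b) \<Rightarrow> bool" where
  "controlled X Y f \<longleftrightarrow> (\<forall>U\<in>coarse_ents X. map_prod f f ` U \<in> coarse_ents Y)"

definition proper_map ::
  "('a, 'm) bc_space_scheme \<Rightarrow> ('b, 'n) bc_space_scheme \<Rightarrow> ('a \<Rightarrow> 'b) \<Rightarrow> bool" where
  "proper_map X Y f \<longleftrightarrow> (\<forall>B\<in>bounded_sets Y. {x \<in> carrier X. f x \<in> B} \<in> bounded_sets X)"

definition bornological_map ::
  "('a, 'm) bc_space_scheme \<Rightarrow> ('b, 'n) bc_space_scheme \<Rightarrow> ('a \<Rightarrow> 'b) \<Rightarrow> bool" where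
  "bornological_map X Y f \<longleftrightarrow> (\<forall>B\<in>bounded_sets X. f ` B \<in> bounded_sets Y)"

definition uniform_map ::
  "('a, 'm) ubc_space_scheme \<Rightarrow> ('b, 'n) ubc_space_scheme \<Rightarrow> ('a \<Rightarrow> 'b) \<Rightarrow> bool" where
  "uniform_map X Y f \<longleftrightarrow>
     (\<forall>V\<in>uniform_ents Y. {(x, y) \<in> carrier X \<times> carrier X. (f x, f y) \<in> V} \<in> uniform_ents X)"

definition bc_automorphism :: "('a, 'm) bc_space_scheme \<Rightarrow> ('a \<Rightarrow> 'a) \<Rightarrow> bool" where
  "bc_automorphism X f \<longleftrightarrow>
     bij_betw f (carrier X) (carrier X) \<and>
     controlled X X f \<and> proper_map X X f \<and>
     controlled X X (inv_into (carrier X) f) \<and> proper_map X X (inv_into (carrier X) f)"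

definition ubc_automorphism :: "('a, 'm) ubc_space_scheme \<Rightarrow> ('a \<Rightarrow> 'a) \<Rightarrow> bool" where
  "ubc_automorphism X f \<longleftrightarrow>
     bc_automorphism X f \<and>
     uniform_map X X f \<and> uniform_map X X (inv_into (carrier X) f)"

definition acts_by_bc_automorphisms ::
  "('g, 'k) monoid_scheme \<Rightarrow> ('a, 'm) bc_space_scheme \<Rightarrow> ('g \<Rightarrow> 'a \<Rightarrow> 'a) \<Rightarrow> bool" where
  "acts_by_bc_automorphisms G X \<phi> \<longleftrightarrow>
     group_action G (carrier X) \<phi> \<and> (\<forall>g\<in>carrier G. bc_automorphism X (\<phi> g))"

definition acts_by_ubc_automorphisms ::
  "('g, 'k) monoid_scheme \<Rightarrow> ('a, 'm) ubc_space_scheme \<Rightarrow> ('g \<Rightarrow> 'a \<Rightarrow> 'a) \<Rightarrow> bool" where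
  "acts_by_ubc_automorphisms G X \<phi> \<longleftrightarrow>
     group_action G (carrier X) \<phi> \<and> (\<forall>g\<in>carrier G. ubc_automorphism X (\<phi> g))"

definition invariant_entourage ::
  "('g, 'k) monoid_scheme \<Rightarrow> ('g \<Rightarrow> 'a \<Rightarrow> 'a) \<Rightarrow> ('a \<times> 'a) set \<Rightarrow> bool" where
  "invariant_entourage G \<phi> U \<longleftrightarrow> (\<forall>g\<in>carrier G. map_prod (\<phi> g) (\<phi> g) ` U = U)"

definition G_bornological_coarse_space ::
  "('g, 'k) monoid_scheme \<Rightarrow> ('a, 'm) bc_space_scheme \<Rightarrow> ('g \<Rightarrow> 'a \<Rightarrow> 'a) \<Rightarrow> bool" where
  "G_bornological_coarse_space G X \<phi> \<longleftrightarrow>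
     bornological_coarse_space X \<and> acts_by_bc_automorphisms G X \<phi> \<and>
     (\<forall>U\<in>coarse_ents X. \<exists>V\<in>coarse_ents X. invariant_entourage G \<phi> V \<and> U \<subseteq> V)"

text \<open>
  A big family is represented by the set of its members: the members of a filtered increasing
  family form a nonempty upwards directed set, which is in turn a filtered increasing family
  indexed by itself.
\<close>

definition big_family :: "('a, 'm) bc_space_scheme \<Rightarrow> 'a set set \<Rightarrow> bool" where
  "big_family X \<Z> \<longleftrightarrow>
     \<Z> \<noteq> {} \<and> \<Z> \<subseteq> Pow (carrier X) \<and>
     (\<forall>Z1\<in>\<Z>. \<forall>Z2\<in>\<Z>. \<exists>Z3\<in>\<Z>. Z1 \<union> Z2 \<subseteq> Z3) \<and>
     (\<forall>Z\<in>\<Z>. \<forall>U\<in>coarse_ents X. \<exists>Z'\<in>\<Z>. thickening U Z \<subseteq> Z')"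

definition with_generator ::
  "('a, 'm) bc_space_scheme \<Rightarrow> ('a \<times> 'a) set \<Rightarrow> ('a, 'm) bc_space_scheme" where
  "with_generator X U = X\<lparr>coarse_ents := coarse_structure (carrier X) hull {U}\<rparr>"

section \<open>The cone\<close>

definition asymptotically_uniform ::
  "('a, 'm) ubc_space_scheme \<Rightarrow> ((int \<times> 'a) \<times> (int \<times> 'a)) set \<Rightarrow> bool" where
  "asymptotically_uniform X W \<longleftrightarrow>
     W \<subseteq> (UNIV \<times> carrier X) \<times> (UNIV \<times> carrier X) \<and>
     (\<forall>V\<in>uniform_ents X. \<exists>n0::int. \<forall>n\<ge>n0. {(x, y). ((n, x), (n, y)) \<in> W} \<subseteq> V)"

definition Sq :: "('a, 'm) ubc_space_scheme \<Rightarrow> (int \<times> 'a) bc_space" where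
  "Sq X = \<lparr>carrier = UNIV \<times> carrier X,
     bounded_sets = bornology (UNIV \<times> carrier X) hull
       {F \<times> B | F B. finite F \<and> B \<in> bounded_sets X},
     coarse_ents = {E. \<exists>U W. U \<in> coarse_ents X \<and> asymptotically_uniform X W \<and>
       E \<subseteq> {((n, x), (n, y)) | n x y. (x, y) \<in> U} \<inter> W}\<rparr>"

definition cone :: "('a, 'm) ubc_space_scheme \<Rightarrow> (int \<times> 'a) bc_space" where
  "cone X = (Sq X)\<lparr>coarse_ents := coarse_structure (UNIV \<times> carrier X) hull
     (coarse_ents (Sq X) \<union> {{((n + 1, x), (n, x)) | n x. x \<in> carrier X}})\<rparr>"

definition cone_action ::
  "('a, 'm) ubc_space_scheme \<Rightarrow> ('g \<Rightarrow> 'a \<Rightarrow> 'a) \<Rightarrow> 'g \<Rightarrow> int \<times> 'a \<Rightarrow> int \<times> 'a" where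
  "cone_action X \<phi> g = (\<lambda>(n, x)\<in>UNIV \<times> carrier X. (n, \<phi> g x))"

definition cone_big_family :: "('a, 'm) ubc_space_scheme \<Rightarrow> (int \<times> 'a) set set" where
  "cone_big_family X = {{..int n} \<times> carrier X | n. True}"

section \<open>Conditions on the action\<close>

definition uniformly_free ::
  "('g, 'k) monoid_scheme \<Rightarrow> ('a, 'm) ubc_space_scheme \<Rightarrow> ('g \<Rightarrow> 'a \<Rightarrow> 'a) \<Rightarrow> bool" where
  "uniformly_free G X \<phi> \<longleftrightarrow>
     (\<forall>g\<in>carrier G. g \<noteq> \<one>\<^bsub>G\<^esub> \<longrightarrow>
        (\<exists>U\<in>uniform_ents X. U \<inter> {(\<phi> g x, x) | x. x \<in> carrier X} = {}))"

definition uniform_scale ::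
  "('a, 'm) ubc_space_scheme \<Rightarrow> (nat \<Rightarrow> ('a \<times> 'a) set) \<Rightarrow> bool" where
  "uniform_scale X U \<longleftrightarrow>
     (\<forall>n. U n \<in> uniform_ents X) \<and>
     (\<forall>V\<in>uniform_ents X. \<forall>\<^sub>F n in sequentially. U n \<subseteq> V)"

definition dominated ::
  "(nat \<Rightarrow> ('a \<times> 'a) set) \<Rightarrow> (nat \<Rightarrow> ('a \<times> 'a) set) \<Rightarrow> bool" where
  "dominated U V \<longleftrightarrow> (\<forall>n. U n \<subseteq> V n)"

text \<open>
  \<^term>\<open>R ^^ 0\<close> is the diagonal of the whole type rather than of the carrier. This is harmless:
  for \<^term>\<open>l = 0\<close> the inclusion below holds in either reading, and for \<^term>\<open>k = 0\<close> its left-hand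
  side lies over the carrier as soon as \<^term>\<open>l \<noteq> 0\<close>.
\<close>

definition Lipschitz_scale ::
  "('g, 'k) monoid_scheme \<Rightarrow> ('a, 'm) ubc_space_scheme \<Rightarrow> ('g \<Rightarrow> 'a \<Rightarrow> 'a) \<Rightarrow>
    (nat \<Rightarrow> ('a \<times> 'a) set) \<Rightarrow> bool" where
  "Lipschitz_scale G X \<phi> V \<longleftrightarrow>
     uniform_scale X V \<and>
     (\<forall>g\<in>carrier G. \<exists>k::nat. \<forall>n l. map_prod (\<phi> g) (\<phi> g) ` (V n ^^ l) \<subseteq> V n ^^ (l * k))"

definition Lipschitz_action ::
  "('g, 'k) monoid_scheme \<Rightarrow> ('a, 'm) ubc_space_scheme \<Rightarrow> ('g \<Rightarrow> 'a \<Rightarrow> 'a) \<Rightarrow> bool" where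
  "Lipschitz_action G X \<phi> \<longleftrightarrow>
     (\<forall>U. uniform_scale X U \<longrightarrow> (\<exists>V. Lipschitz_scale G X \<phi> V \<and> dominated U V))"

section \<open>Quotients and semidirect products\<close>

definition coarse_quotient ::
  "('g, 'k) monoid_scheme \<Rightarrow> ('a, 'm) bc_space_scheme \<Rightarrow> ('g \<Rightarrow> 'a \<Rightarrow> 'a) \<Rightarrow>
    ('a, 'm) bc_space_scheme" where
  "coarse_quotient G Y \<phi> = Y\<lparr>coarse_ents := coarse_structure (carrier Y) hull
     (coarse_ents Y \<union> {{(\<phi> g y, y) | y. y \<in> carrier Y} | g. g \<in> carrier G})\<rparr>"

definition semidirect_ent ::
  "('g, 'k) monoid_scheme \<Rightarrow> ('a, 'm) bc_space_scheme \<Rightarrow> ('g \<Rightarrow> 'a \<Rightarrow> 'a) \<Rightarrow>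
    ('a \<times> 'a) set \<Rightarrow> (('g \<times> 'a) \<times> ('g \<times> 'a)) set" where
  "semidirect_ent G Y \<phi> W =
     {((g, y'), (g, y)) | g y' y. g \<in> carrier G \<and> y' \<in> carrier Y \<and> y \<in> carrier Y \<and>
        (\<phi> (inv\<^bsub>G\<^esub> g) y', \<phi> (inv\<^bsub>G\<^esub> g) y) \<in> W}"

definition semidirect ::
  "('g, 'k) monoid_scheme \<Rightarrow> ('a, 'm) bc_space_scheme \<Rightarrow> ('g \<Rightarrow> 'a \<Rightarrow> 'a) \<Rightarrow>
    ('g \<times> 'a) bc_space" where
  "semidirect G Y \<phi> = \<lparr>carrier = carrier G \<times> carrier Y,
     bounded_sets = bornology (carrier G \<times> carrier Y) hull
       {F \<times> B | F B. F \<subseteq> carrier G \<and> finite F \<and> B \<in> bounded_sets Y},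
     coarse_ents = coarse_structure (carrier G \<times> carrier Y) hull
       {semidirect_ent G Y \<phi> W | W. W \<in> coarse_ents Y}\<rparr>"

definition diagonal_action ::
  "('g, 'k) monoid_scheme \<Rightarrow> ('a, 'm) bc_space_scheme \<Rightarrow> ('g \<Rightarrow> 'a \<Rightarrow> 'a) \<Rightarrow>
    'g \<Rightarrow> 'g \<times> 'a \<Rightarrow> 'g \<times> 'a" where
  "diagonal_action G Y \<phi> h = (\<lambda>(g, y)\<in>carrier G \<times> carrier Y. (h \<otimes>\<^bsub>G\<^esub> g, \<phi> h y))"

text \<open>
  Right multiplication is turned into a left action by inverting; with this convention the map
  sending \<^term>\<open>(g, y)\<close> to \<phi> (inv g) y intertwines it with the action on \<^term>\<open>Y\<close>.
\<close>

definition right_action ::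
  "('g, 'k) monoid_scheme \<Rightarrow> ('a, 'm) bc_space_scheme \<Rightarrow> 'g \<Rightarrow> 'g \<times> 'a \<Rightarrow> 'g \<times> 'a" where
  "right_action G Y h = (\<lambda>(g, y)\<in>carrier G \<times> carrier Y. (g \<otimes>\<^bsub>G\<^esub> inv\<^bsub>G\<^esub> h, y))"

definition semidirect_quotient ::
  "('g, 'k) monoid_scheme \<Rightarrow> ('a, 'm) bc_space_scheme \<Rightarrow> ('g \<Rightarrow> 'a \<Rightarrow> 'a) \<Rightarrow>
    ('g \<times> 'a) bc_space" where
  "semidirect_quotient G Y \<phi> = coarse_quotient G (semidirect G Y \<phi>) (right_action G Y)"

section \<open>Branched coarse coverings\<close>

definition locally_finite_fibres ::
  "('a, 'm) bc_space_scheme \<Rightarrow> ('b, 'n) bc_space_scheme \<Rightarrow> ('a \<Rightarrow> 'b) \<Rightarrow> bool" where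
  "locally_finite_fibres A B f \<longleftrightarrow>
     (\<forall>b\<in>carrier B. \<forall>C\<in>bounded_sets A. finite ({a \<in> carrier A. f a = b} \<inter> C))"

text \<open>
  The group acts trivially on \<^term>\<open>B\<close>, so equivariance of \<^term>\<open>f\<close> means invariance. The
  requirements on \<^term>\<open>A\<close>, \<^term>\<open>B\<close> and \<^term>\<open>\<Z>\<close> under which the notion makes sense are part of the
  definition. The entourage \<^term>\<open>P\<close> itself is not required to be coarse.
\<close>

definition branched_coarse_covering ::
  "('g, 'k) monoid_scheme \<Rightarrow> ('a, 'm) bc_space_scheme \<Rightarrow> ('g \<Rightarrow> 'a \<Rightarrow> 'a) \<Rightarrow>
    ('b, 'n) bc_space_scheme \<Rightarrow> 'b set set \<Rightarrow> ('a \<Rightarrow> 'b) \<Rightarrow> bool" where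
  "branched_coarse_covering G A \<alpha> B \<Z> f \<longleftrightarrow>
     G_bornological_coarse_space G A \<alpha> \<and> bornological_coarse_space B \<and> big_family B \<Z> \<and>
     f \<in> carrier A \<rightarrow> carrier B \<and>
     (\<forall>g\<in>carrier G. \<forall>a\<in>carrier A. f (\<alpha> g a) = f a) \<and>
     controlled A B f \<and> bornological_map A B f \<and> locally_finite_fibres A B f \<and>
     (\<exists>P. P \<subseteq> carrier A \<times> carrier A \<and> invariant_entourage G \<alpha> P \<and>
        (\<forall>V\<in>coarse_ents B. \<exists>Z\<in>\<Z>.
           (\<forall>(b', b) \<in> V \<inter> (carrier B \<times> (carrier B - Z)). \<forall>a\<in>carrier A. f a = b \<longrightarrow>
              (\<exists>!a'. a' \<in> carrier A \<and> f a' = b' \<and> (a', a) \<in> P)) \<and>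
           P \<inter> {(a', a) \<in> carrier A \<times> carrier A.
                 (f a', f a) \<in> V \<inter> (carrier B \<times> (carrier B - Z))} \<in> coarse_ents A) \<and>
        (\<forall>U\<in>coarse_ents A. \<exists>Z\<in>\<Z>.
           U \<inter> (carrier A \<times> {a \<in> carrier A. f a \<in> carrier B - Z}) \<subseteq> P))"

end

theory Submission
  imports Defs
begin

text \<open>
  Let \<^term>\<open>V\<close> be a symmetric reflexive entourage of the cone such that every group element maps
  \<^term>\<open>V\<close> into a power of \<^term>\<open>V\<close>; the Lipschitz condition makes these cofinal. Moving all group
  elements to one side, the entourages of the quotient are generated by the sets of pairs (b', b) such
  that (h b', b) lies in V^l for some h in F_l, where F_l are finite sets exhausting the countable
  group, and the entourages upstairs have the same description with h recording the change of sheet.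
  By uniform freeness, for each l the element h is determined by (b', b) once b lies outside a member
  Z_l of the big family, since powers of \<^term>\<open>V\<close> become uniformly small far out in the cone. The
  entourage P consists of the pairs in the fibres over (b', b) differing by such an h, for some l with
  b outside Z_l; as the F_l and the powers V^l increase with l, h is unique even without fixing l.
\<close>

section \<open>Generated structures\<close>

text \<open>The uniform structure of \<open>X\<close> need not have invariant entourages, so a
  coarse entourage of the cone need not lie in an invariant one. A translate of \<open>V\<close> is
  therefore only required to lie in a power of \<open>V\<close>, which the structure generated by
  \<open>V\<close> absorbs. To enlarge a given entourage E to such a \<open>V\<close>, the parts of
  E beyond level i are joined to a uniform scale; the result is again a uniform scale, and stage i
  of a dominating Lipschitz scale contains what E does from level i on. The constant of a group
  element is the same for all stages, so one exponent serves all levels. The obstacle is that early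
  stages need not be coarse on X, while cutting them down by a coarse entourage might destroy the
  Lipschitz property; low levels therefore use an invariant coarse entourage instead. Countability
  enters through a chain: F_l and V^l carry the same index l, so the indices belonging to two
  candidates for h are comparable, and the larger one decides.\<close>

lemma coarse_structureD:
  assumes "coarse_structure X \<C>"
  shows coarse_structure_carrier: "U \<in> \<C> \<Longrightarrow> U \<subseteq> X \<times> X"
    and coarse_structure_Id_on: "Id_on X \<in> \<C>"
    and coarse_structure_subset: "U \<in> \<C> \<Longrightarrow> V \<subseteq> U \<Longrightarrow> V \<in> \<C>"
    and coarse_structure_Un: "U \<in> \<C> \<Longrightarrow> V \<in> \<C> \<Longrightarrow> U \<union> V \<in> \<C>"
    and coarse_structure_converse: "U \<in> \<C> \<Longrightarrow> U\<inverse> \<in> \<C>"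
    and coarse_structure_relcomp: "U \<in> \<C> \<Longrightarrow> V \<in> \<C> \<Longrightarrow> U O V \<in> \<C>"
  using assms by (simp_all add: coarse_structure_def subset_iff[of \<C> "Pow _"])

lemma coarse_structure_UN:
  assumes C: "coarse_structure X \<C>" and "finite I" "\<And>i. i \<in> I \<Longrightarrow> U i \<in> \<C>"
  shows "(\<Union>i\<in>I. U i) \<in> \<C>"
  using assms(2,3)
proof (induction I rule: finite_induct)
  case empty
  show ?case
    using coarse_structure_subset[OF C coarse_structure_Id_on[OF C]] by simp
next
  case (insert i I)
  then show ?case
    using coarse_structure_Un[OF C] by simp
qed

lemma coarse_structure_relpow:
  assumes C: "coarse_structure X \<C>" and U: "U \<in> \<C>"
  shows "(U ^^ l) \<inter> X \<times> X \<in> \<C>"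
proof (induction l)
  case 0
  show ?case
    by (rule coarse_structure_subset[OF C coarse_structure_Id_on[OF C]]) auto
next
  case (Suc l)
  have "(U ^^ Suc l) \<inter> X \<times> X \<subseteq> ((U ^^ l) \<inter> X \<times> X) O U"
    using coarse_structure_carrier[OF C U] by auto
  then show ?case
    using coarse_structure_subset[OF C coarse_structure_relcomp[OF C Suc U]] by blast
qed

text \<open>Entourages below different members of an increasing sequence lie below a common one, so
  each axiom reduces to a single member, and its result may lie below any other. Closure under
  subsets is built into the description.\<close>

lemma coarse_structure_tower:
  fixes N :: "nat \<Rightarrow> ('a \<times> 'a) set"
  assumes mono: "\<And>l m. l \<le> m \<Longrightarrow> N l \<subseteq> N m"
    and carrier: "\<And>l. N l \<subseteq> X \<times> X"
    and refl: "Id_on X \<subseteq> N r"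
    and sym: "\<And>l. \<exists>m. (N l)\<inverse> \<subseteq> N m"
    and trans: "\<And>l. \<exists>m. N l O N l \<subseteq> N m"
  shows "coarse_structure X {E. \<exists>l. E \<subseteq> N l}"
proof -
  have max: "N l \<subseteq> N (max l m)" "N m \<subseteq> N (max l m)" for l m
    using mono by simp_all
  have "\<exists>n. U \<union> U' \<subseteq> N n" if "U \<subseteq> N l" "U' \<subseteq> N m" for U U' l m
    using that max[where l = l and m = m] by (intro exI[of _ "max l m"]) auto
  moreover have "\<exists>n. U O U' \<subseteq> N n" if "U \<subseteq> N l" "U' \<subseteq> N m" for U U' l m
  proof -
    obtain n where "N (max l m) O N (max l m) \<subseteq> N n"
      using trans by meson
    then show ?thesis
      using relcomp_mono[OF order_trans[OF that(1) max(1)] order_trans[OF that(2) max(2)]] by (meson order_trans)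
  qed
  moreover have "\<exists>n. U\<inverse> \<subseteq> N n" if U: "U \<subseteq> N l" for U l
  proof -
    obtain m where "(N l)\<inverse> \<subseteq> N m"
      using sym by meson
    then show ?thesis
      using U by (meson converse_mono order_trans)
  qed
  moreover have "{E. \<exists>l. E \<subseteq> N l} \<subseteq> Pow (X \<times> X)"
    using carrier by blast
  ultimately show ?thesis
    unfolding coarse_structure_def mem_Collect_eq using refl
    by (intro conjI allI impI) (assumption | meson order_trans)+
qed

text \<open>Turns a quantifier over a generated coarse structure into one over \<open>l\<close>. The
  last premise gives minimality: every competing structure must already contain each
  \<open>N l\<close>.\<close>

lemma coarse_structure_hull_tower:
  fixes N :: "nat \<Rightarrow> ('a \<times> 'a) set"
  assumes "coarse_structure X {E. \<exists>l. E \<subseteq> N l}"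
    and "S \<subseteq> {E. \<exists>l. E \<subseteq> N l}"
    and "\<And>\<D> l. coarse_structure X \<D> \<Longrightarrow> S \<subseteq> \<D> \<Longrightarrow> N l \<in> \<D>"
  shows "coarse_structure X hull S = {E. \<exists>l. E \<subseteq> N l}"
proof (rule hull_unique)
  fix \<D>
  assume S: "S \<subseteq> \<D>" and D: "coarse_structure X \<D>"
  show "{E. \<exists>l. E \<subseteq> N l} \<subseteq> \<D>"
  proof
    fix E
    assume "E \<in> {E. \<exists>l. E \<subseteq> N l}"
    then obtain l where "E \<subseteq> N l"
      by auto
    then show "E \<in> \<D>"
      using coarse_structure_subset[OF D assms(3)[OF D S]] by meson
  qed
next
  show "S \<subseteq> {E. \<exists>l. E \<subseteq> N l}"
    by (rule assms(2))
next
  show "coarse_structure X {E. \<exists>l. E \<subseteq> N l}"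
    by (rule assms(1))
qed

section \<open>Bornologies and product bornologies\<close>

lemma bornologyD:
  assumes "bornology X \<B>"
  shows bornology_carrier: "A \<in> \<B> \<Longrightarrow> A \<subseteq> X"
    and bornology_subset: "A \<in> \<B> \<Longrightarrow> B \<subseteq> A \<Longrightarrow> B \<in> \<B>"
    and bornology_Un: "A \<in> \<B> \<Longrightarrow> B \<in> \<B> \<Longrightarrow> A \<union> B \<in> \<B>"
proof -
  have B: "\<Union>\<B> = X" "\<forall>A B. A \<in> \<B> \<and> B \<subseteq> A \<longrightarrow> B \<in> \<B>" "\<forall>A B. A \<in> \<B> \<and> B \<in> \<B> \<longrightarrow> A \<union> B \<in> \<B>"
    using assms by (simp_all add: bornology_def)
  show "A \<in> \<B> \<Longrightarrow> A \<subseteq> X"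
    using B(1) by blast
  show "A \<in> \<B> \<Longrightarrow> B \<subseteq> A \<Longrightarrow> B \<in> \<B>"
    using B(2) by simp
  show "A \<in> \<B> \<Longrightarrow> B \<in> \<B> \<Longrightarrow> A \<union> B \<in> \<B>"
    using B(3) by simp
qed

lemma bornology_UN:
  assumes B: "bornology X \<B>" and "finite I" "\<And>i. i \<in> I \<Longrightarrow> A i \<in> \<B>"
  shows "(\<Union>i\<in>I. A i) \<in> \<B>"
  using assms(2,3)
proof (induction I rule: finite_induct)
  case empty
  show ?case
    using B by (simp add: bornology_def)
next
  case (insert i I)
  then show ?case
    using bornology_Un[OF B] by simp
qed

lemma product_bornology:
  assumes B: "bornology X \<B>"
  shows "bornology (I \<times> X) {A. \<exists>F B. F \<subseteq> I \<and> finite F \<and> B \<in> \<B> \<and> A \<subseteq> F \<times> B}" (is "bornology _ ?P")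
proof -
  have "A1 \<union> A2 \<in> ?P" if A1: "A1 \<in> ?P" and A2: "A2 \<in> ?P" for A1 A2
  proof -
    obtain F1 B1 where 1: "F1 \<subseteq> I" "finite F1" "B1 \<in> \<B>" "A1 \<subseteq> F1 \<times> B1"
      using A1 by blast
    obtain F2 B2 where 2: "F2 \<subseteq> I" "finite F2" "B2 \<in> \<B>" "A2 \<subseteq> F2 \<times> B2"
      using A2 by blast
    have "A1 \<union> A2 \<subseteq> (F1 \<union> F2) \<times> (B1 \<union> B2)"
      using 1(4) 2(4) by (intro Un_least; elim order_trans) auto
    moreover have "F1 \<union> F2 \<subseteq> I" "finite (F1 \<union> F2)" "B1 \<union> B2 \<in> \<B>"
      using 1 2 bornology_Un[OF B] by simp_all
    ultimately show ?thesis
      unfolding mem_Collect_eq by meson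
  qed
  moreover have "A' \<in> ?P" if "A \<in> ?P" "A' \<subseteq> A" for A A'
    using that by (smt (verit, best) mem_Collect_eq subset_trans)
  moreover have "\<Union>?P = I \<times> X"
  proof
    show "\<Union>?P \<subseteq> I \<times> X"
      using bornology_carrier[OF B] by blast
    show "I \<times> X \<subseteq> \<Union>?P"
    proof
      fix p
      assume p: "p \<in> I \<times> X"
      then have "snd p \<in> \<Union>\<B>"
        using B by (auto simp: bornology_def)
      then obtain B0 where "B0 \<in> \<B>" "snd p \<in> B0"
        by blast
      then have "{p} \<in> ?P"
        using p by (auto intro!: exI[of _ "{fst p}"] exI[of _ B0])
      then show "p \<in> \<Union>?P"
        by blast
    qed
  qed
  moreover have "{} \<in> ?P"
    using B by (auto simp: bornology_def)
  ultimately show ?thesis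
    unfolding bornology_def by meson
qed

text \<open>\<open>I\<close> is \<open>UNIV\<close> for the cone and \<open>carrier G\<close> for
  the semidirect product, so one description serves both generated bornologies.\<close>

lemma product_bornology_hull:
  assumes B: "bornology X \<B>"
  shows "bornology (I \<times> X) hull {F \<times> B | F B. F \<subseteq> I \<and> finite F \<and> B \<in> \<B>}
    = {A. \<exists>F B. F \<subseteq> I \<and> finite F \<and> B \<in> \<B> \<and> A \<subseteq> F \<times> B}"
proof (rule hull_unique)
  show "bornology (I \<times> X) {A. \<exists>F B. F \<subseteq> I \<and> finite F \<and> B \<in> \<B> \<and> A \<subseteq> F \<times> B}"
    by (rule product_bornology[OF B])
next
  fix \<A>
  assume S: "{F \<times> B | F B. F \<subseteq> I \<and> finite F \<and> B \<in> \<B>} \<subseteq> \<A>" and A: "bornology (I \<times> X) \<A>"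
  show "{A. \<exists>F B. F \<subseteq> I \<and> finite F \<and> B \<in> \<B> \<and> A \<subseteq> F \<times> B} \<subseteq> \<A>"
  proof
    fix K
    assume "K \<in> {A. \<exists>F B. F \<subseteq> I \<and> finite F \<and> B \<in> \<B> \<and> A \<subseteq> F \<times> B}"
    then obtain F B where "F \<subseteq> I" "finite F" "B \<in> \<B>" "K \<subseteq> F \<times> B"
      by auto
    moreover then have "F \<times> B \<in> \<A>"
      using S by blast
    ultimately show "K \<in> \<A>"
      using bornology_subset[OF A] by meson
  qed
qed blast

section \<open>Group actions by automorphisms\<close>

text \<open>\<open>group_action\<close> asks for maps in \<open>Bij E\<close>, which are
  extensional; hence the restriction. Bijectivity comes from the inverse group element.\<close>

lemma group_action_restrictI:
  assumes G: "group G"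
    and closed: "\<And>g x. g \<in> carrier G \<Longrightarrow> x \<in> E \<Longrightarrow> \<psi> g x \<in> E"
    and one: "\<And>x. x \<in> E \<Longrightarrow> \<psi> \<one>\<^bsub>G\<^esub> x = x"
    and mult: "\<And>g h x. g \<in> carrier G \<Longrightarrow> h \<in> carrier G \<Longrightarrow> x \<in> E \<Longrightarrow>
      \<psi> (g \<otimes>\<^bsub>G\<^esub> h) x = \<psi> g (\<psi> h x)"
  shows "group_action G E (\<lambda>g. restrict (\<psi> g) E)"
proof -
  interpret group G by (rule G)
  have inv: "\<psi> (inv\<^bsub>G\<^esub> g) (\<psi> g x) = x" "\<psi> g (\<psi> (inv\<^bsub>G\<^esub> g) x) = x" if "g \<in> carrier G" "x \<in> E" for g x
    using that one mult[of "inv\<^bsub>G\<^esub> g" g x] mult[of g "inv\<^bsub>G\<^esub> g" x] by simp_all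
  have bij: "restrict (\<psi> g) E \<in> Bij E" if g: "g \<in> carrier G" for g
  proof -
    have "bij_betw (\<psi> g) E E"
      by (rule bij_betwI[where g = "\<psi> (inv\<^bsub>G\<^esub> g)"]) (use g inv closed in auto)
    then show ?thesis
      by (simp add: Bij_def bij_betw_restrict_eq)
  qed
  have "restrict (\<psi> (g \<otimes>\<^bsub>G\<^esub> h)) E = compose E (restrict (\<psi> g) E) (restrict (\<psi> h) E)"
    if "g \<in> carrier G" "h \<in> carrier G" for g h
    using that mult closed by (auto simp: compose_def restrict_def)
  then show ?thesis
    unfolding group_action_def group_hom_def group_hom_axioms_def hom_def
    using G group_BijGroup bij by (auto simp: BijGroup_def)
qed

text \<open>The inverse of \<open>\<phi> g\<close> is \<open>\<phi> (inv g)\<close>, so properness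
  of either map is boundedness of images under the other, and it is enough to look at
  images.\<close>

lemma acts_by_bc_automorphismsI:
  fixes G (structure)
  assumes action: "group_action G (carrier X) \<phi>"
    and bcs: "bornological_coarse_space X"
    and controlled: "\<And>g. g \<in> carrier G \<Longrightarrow> controlled X X (\<phi> g)"
    and bounded: "\<And>g. g \<in> carrier G \<Longrightarrow> bornological_map X X (\<phi> g)"
  shows "acts_by_bc_automorphisms G X \<phi>"
proof -
  define E where E: "E = carrier X"
  interpret group_action G E \<phi>
    using action by (simp add: E)
  interpret group G
    using group_hom group_hom.axioms(1) by auto
  have C: "coarse_structure (carrier X) (coarse_ents X)" and B: "bornology (carrier X) (bounded_sets X)"
    using bcs by (auto simp: bornological_coarse_space_def)
  have inverse: "inv_into E (\<phi> g) x = \<phi> (inv g) x" if "g \<in> carrier G" "x \<in> E" for g x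
    using that bij_prop1[of g x] inj_prop[of g] orbit_sym_aux[of g]
    by (metis inv_into_f_f)
  have "bc_automorphism X (\<phi> g)" if g: "g \<in> carrier G" for g
  proof -
    have "{x \<in> carrier X. \<phi> g x \<in> K} = \<phi> (inv g) ` K" if "K \<in> bounded_sets X" for K
      using bornology_carrier[OF B that] g
      by (auto simp: image_iff E[symmetric] intro: element_image)
        (metis orbit_sym_aux subsetD, metis inv_closed inv_inv orbit_sym_aux subsetD)
    moreover have "{x \<in> carrier X. inv_into E (\<phi> g) x \<in> K} = \<phi> g ` K" if "K \<in> bounded_sets X" for K
      using bornology_carrier[OF B that] g
      by (auto simp: image_iff E[symmetric] inverse cong: conj_cong intro: element_image)
        (metis inv_closed inv_inv orbit_sym_aux subsetD, metis element_image inverse orbit_sym_aux subsetD)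
    moreover have "map_prod (inv_into E (\<phi> g)) (inv_into E (\<phi> g)) ` U = map_prod (\<phi> (inv g)) (\<phi> (inv g)) ` U"
      if "U \<in> coarse_ents X" for U
      using coarse_structure_carrier[OF C that] g inverse
      by (intro image_cong) (auto simp: E)
    moreover have "bij_betw (\<phi> g) E E"
      using bij_prop0[OF g] by (simp add: Bij_def)
    ultimately show ?thesis
      using controlled[of g] controlled[of "inv g"] bounded[of g] bounded[of "inv g"] g
      unfolding bc_automorphism_def controlled_def proper_map_def bornological_map_def E[symmetric]
      by (simp add: E)
  qed
  then show ?thesis
    unfolding acts_by_bc_automorphisms_def using group_action_axioms E by auto
qed

section \<open>Powers of a relation under reversal and under Lipschitz maps\<close>

lemma relpow_sym:
  assumes "V\<inverse> = V" and "(x, y) \<in> V ^^ l"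
  shows "(y, x) \<in> V ^^ l"
  using assms(2)
proof (induction l arbitrary: y)
  case (Suc l)
  then obtain z where "(x, z) \<in> V ^^ l" "(z, y) \<in> V"
    by auto
  then show ?case
    using Suc.IH assms(1) by (metis converse_iff relpow_Suc_I2)
qed simp

text \<open>Each of the \<open>l\<close> steps of a chain becomes a chain of \<open>k\<close> steps,
  so a bound for \<open>V\<close> alone controls all its powers.\<close>

lemma relpow_Lipschitz:
  assumes "map_prod \<psi> \<psi> ` V \<subseteq> V ^^ k" and "(x, y) \<in> V ^^ l"
  shows "(\<psi> x, \<psi> y) \<in> V ^^ (l * k)"
  using assms(2)
proof (induction l arbitrary: y)
  case (Suc l)
  then obtain z where "(x, z) \<in> V ^^ l" "(z, y) \<in> V"
    by auto
  then have "(\<psi> x, \<psi> z) \<in> V ^^ (l * k)" "(\<psi> z, \<psi> y) \<in> V ^^ k"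
    using Suc.IH assms(1) by (auto simp: image_subset_iff)
  then show ?case
    using relpow_trans by (fastforce simp: add.commute)
qed simp

section \<open>Lipschitz entourages\<close>

text \<open>Isolates what the covering argument takes from the cone: \<open>Y\<close> will be the
  cone and \<open>F\<close> an exhaustion of the countable group by finite sets.
  \<open>V_Lipschitz\<close> takes the place of invariance of \<open>V\<close>, with an exponent
  depending on the group element.\<close>

locale lipschitz_entourage = group_action G "carrier Y" \<psi>
  for G :: "('g, 'k) monoid_scheme" (structure)
    and Y :: "('a, 'm) bc_space_scheme"
    and \<psi> :: "'g \<Rightarrow> 'a \<Rightarrow> 'a" +
  fixes V :: "('a \<times> 'a) set" and F :: "nat \<Rightarrow> 'g set"
  assumes bcs: "bornological_coarse_space Y"
    and action_bounded: "\<And>g B. g \<in> carrier G \<Longrightarrow> B \<in> bounded_sets Y \<Longrightarrow> \<psi> g ` B \<in> bounded_sets Y"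
    and V_coarse: "V \<in> coarse_ents Y"
    and V_refl: "Id_on (carrier Y) \<subseteq> V"
    and V_sym: "V\<inverse> = V"
    and V_Lipschitz: "\<And>g. g \<in> carrier G \<Longrightarrow> \<exists>k. map_prod (\<psi> g) (\<psi> g) ` V \<subseteq> V ^^ k"
    and F_finite: "\<And>l. finite (F l)"
    and F_mono: "\<And>l m. l \<le> m \<Longrightarrow> F l \<subseteq> F m"
    and F_Union: "(\<Union>l. F l) = carrier G"
begin

sublocale group G
  using group_hom group_hom.axioms(1) by auto

lemma coarse: "coarse_structure (carrier Y) (coarse_ents Y)"
  and bornology: "bornology (carrier Y) (bounded_sets Y)"
  using bcs by (simp_all add: bornological_coarse_space_def)

lemma F_carrier: "g \<in> F l \<Longrightarrow> g \<in> carrier G"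
  using F_Union by blast

lemma finite_subset_F:
  assumes "finite S" "S \<subseteq> carrier G"
  shows "\<exists>l. S \<subseteq> F l"
  using assms
proof (induction S rule: finite_induct)
  case (insert g S)
  then obtain l where "S \<subseteq> F l"
    by auto
  moreover obtain m where "g \<in> F m"
    using insert.prems F_Union by blast
  ultimately have "insert g S \<subseteq> F (max l m)"
    using F_mono[of l "max l m"] F_mono[of m "max l m"] by auto
  then show ?case ..
qed simp

lemma closed [simp]: "g \<in> carrier G \<Longrightarrow> y \<in> carrier Y \<Longrightarrow> \<psi> g y \<in> carrier Y"
  using element_image by blast

lemma action_one [simp]: "y \<in> carrier Y \<Longrightarrow> \<psi> \<one> y = y"
  by (metis id_eq_one restrict_apply')

lemma action_inv [simp]:
  assumes "g \<in> carrier G" "y \<in> carrier Y"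
  shows "\<psi> (inv g) (\<psi> g y) = y" "\<psi> g (\<psi> (inv g) y) = y"
  using assms by (simp_all flip: composition_rule)

lemma cancel [simp]:
  assumes "g \<in> carrier G" "h \<in> carrier G"
  shows "inv g \<otimes> (g \<otimes> h) = h" "g \<otimes> (inv g \<otimes> h) = h"
  using assms by (simp_all flip: m_assoc)

text \<open>The intersection matters only for \<open>l = 0\<close>, where \<open>V ^^ 0\<close> is
  the diagonal of the whole type; \<open>V\<close> itself lies over the carrier.\<close>

definition near :: "nat \<Rightarrow> ('a \<times> 'a) set" where
  "near l = (V ^^ l) \<inter> carrier Y \<times> carrier Y"

lemma near_carrier: "(x, y) \<in> near l \<Longrightarrow> x \<in> carrier Y" "(x, y) \<in> near l \<Longrightarrow> y \<in> carrier Y"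
  by (simp_all add: near_def)

lemma near_coarse: "near l \<in> coarse_ents Y"
  unfolding near_def by (rule coarse_structure_relpow[OF coarse V_coarse])

lemma near_trans: "(x, y) \<in> near l \<Longrightarrow> (y, z) \<in> near m \<Longrightarrow> (x, z) \<in> near (l + m)"
  by (auto simp: near_def relpow_add)

lemma near_refl: "x \<in> carrier Y \<Longrightarrow> (x, x) \<in> near l"
proof (induction l)
  case (Suc l)
  then show ?case
    using V_refl by (auto simp: near_def)
qed (simp add: near_def)

lemma near_mono:
  assumes "l \<le> m"
  shows "near l \<subseteq> near m"
proof (rule subrelI)
  fix x y
  assume xy: "(x, y) \<in> near l"
  show "(x, y) \<in> near m"
    using near_trans[OF xy near_refl[OF near_carrier(2)[OF xy], of "m - l"]] assms by simp
qed

lemma near_sym: "(x, y) \<in> near l \<Longrightarrow> (y, x) \<in> near l"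
  by (simp add: near_def relpow_sym[OF V_sym])

lemma coarse_structure_near: "coarse_structure (carrier Y) {E. \<exists>l. E \<subseteq> near l}"
proof (rule coarse_structure_tower)
  show "near l \<subseteq> near m" if "l \<le> m" for l m
    using that by (rule near_mono)
  show "near l \<subseteq> carrier Y \<times> carrier Y" for l
    by (simp add: near_def)
  show "Id_on (carrier Y) \<subseteq> near 0"
    using near_refl by auto
  have "(near l)\<inverse> \<subseteq> near l" for l
    using near_sym by auto
  then show "\<exists>m. (near l)\<inverse> \<subseteq> near m" for l
    by blast
  have "near l O near l \<subseteq> near (l + l)" for l
    using near_trans by auto
  then show "\<exists>m. near l O near l \<subseteq> near m" for l
    by blast
qed

lemma near_in_coarse_structure:
  assumes \<D>: "coarse_structure (carrier Y) \<D>" and "V \<in> \<D>"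
  shows "near l \<in> \<D>"
  unfolding near_def by (rule coarse_structure_relpow[OF assms])

text \<open>Because \<open>V\<close> is reflexive and symmetric, its powers already absorb unions
  and inverses, so they are cofinal in the structure that it generates.\<close>

lemma coarse_ents_with_generator: "coarse_ents (with_generator Y V) = {E. \<exists>l. E \<subseteq> near l}"
proof -
  have "V \<subseteq> near 1"
    using coarse_structure_carrier[OF coarse V_coarse] by (auto simp: near_def)
  then show ?thesis
    using near_in_coarse_structure coarse_structure_near unfolding with_generator_def
    by (simp, intro coarse_structure_hull_tower) blast+
qed

lemma with_generator_simps [simp]:
  "carrier (with_generator Y V) = carrier Y"
  "bounded_sets (with_generator Y V) = bounded_sets Y"
  by (simp_all add: with_generator_def)

text \<open>One \<open>m\<close> serves all of \<open>F j\<close>: this set is finite, so the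
  exponents of its elements have a maximum. This carries a group element past a chain of
  \<open>V\<close>-steps.\<close>

lemma action_near:
  "\<exists>m. \<forall>h\<in>F j. \<forall>x y. (x, y) \<in> near l \<longrightarrow> (\<psi> h x, \<psi> h y) \<in> near m"
proof -
  have "\<exists>m. \<forall>x y. (x, y) \<in> near l \<longrightarrow> (\<psi> h x, \<psi> h y) \<in> near m" if "h \<in> F j" for h
  proof -
    have h: "h \<in> carrier G"
      using that by (rule F_carrier)
    then obtain k where "map_prod (\<psi> h) (\<psi> h) ` V \<subseteq> V ^^ k"
      using V_Lipschitz by blast
    then have "(\<psi> h x, \<psi> h y) \<in> near (l * k)" if "(x, y) \<in> near l" for x y
      using that h relpow_Lipschitz[of "\<psi> h" V k x y l] by (auto simp: near_def)
    then show ?thesis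
      by blast
  qed
  then obtain m where m: "(\<psi> h x, \<psi> h y) \<in> near (m h)" if "h \<in> F j" "(x, y) \<in> near l" for h x y
    by metis
  have "near (m h) \<subseteq> near (Max (m ` F j))" if "h \<in> F j" for h
    using that F_finite by (intro near_mono) simp
  then show ?thesis
    using m by blast
qed

section \<open>The quotient\<close>

definition quotient_near :: "nat \<Rightarrow> ('a \<times> 'a) set" where
  "quotient_near l = {(b', b). b' \<in> carrier Y \<and> b \<in> carrier Y \<and> (\<exists>h\<in>F l. (\<psi> h b', b) \<in> near l)}"

lemma F_products: "\<exists>p. \<forall>h\<in>F l. \<forall>h'\<in>F l. h \<otimes> h' \<in> F p"
proof -
  have "finite ((\<lambda>(h, h'). h \<otimes> h') ` (F l \<times> F l))" "(\<lambda>(h, h'). h \<otimes> h') ` (F l \<times> F l) \<subseteq> carrier G"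
    using F_finite F_carrier by auto
  from finite_subset_F[OF this] show ?thesis
    by fastforce
qed

lemma F_inverses: "\<exists>p. \<forall>h\<in>F l. inv h \<in> F p"
proof -
  have "finite (m_inv G ` F l)" "m_inv G ` F l \<subseteq> carrier G"
    using F_finite F_carrier by auto
  from finite_subset_F[OF this] show ?thesis
    by auto
qed

text \<open>Inverting a pair (h b', b) requires applying \<open>inv h\<close>, and composing
  requires applying \<open>h\<close> to a pair (h' b'', b'). By \<open>action_near\<close> the
  result stays within a power of \<open>V\<close>, while \<open>F_inverses\<close> and
  \<open>F_products\<close> place the new group element in some \<open>F p\<close>.\<close>

lemma coarse_structure_quotient_near: "coarse_structure (carrier Y) {E. \<exists>l. E \<subseteq> quotient_near l}"
proof -
  obtain r where r: "\<one> \<in> F r"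
    using F_Union one_closed by blast
  show ?thesis
  proof (rule coarse_structure_tower)
    show "quotient_near l \<subseteq> quotient_near m" if "l \<le> m" for l m
      unfolding quotient_near_def using F_mono[OF that] near_mono[OF that] by fast
    show "quotient_near l \<subseteq> carrier Y \<times> carrier Y" for l
      by (auto simp: quotient_near_def)
    show "Id_on (carrier Y) \<subseteq> quotient_near r"
      using r near_refl by (auto simp: quotient_near_def intro!: bexI[of _ \<one>])
  next
    fix l
    obtain p where p: "\<forall>h\<in>F l. inv h \<in> F p"
      using F_inverses by blast
    obtain m where m: "\<forall>h\<in>F p. \<forall>x y. (x, y) \<in> near l \<longrightarrow> (\<psi> h x, \<psi> h y) \<in> near m"
      using action_near by blast
    have "(b, b') \<in> quotient_near (max p m)" if bb: "(b', b) \<in> quotient_near l" for b' b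
    proof -
      obtain h where h: "h \<in> F l" "(\<psi> h b', b) \<in> near l" and b: "b' \<in> carrier Y" "b \<in> carrier Y"
        using bb by (auto simp: quotient_near_def)
      have "(\<psi> (inv h) b, \<psi> (inv h) (\<psi> h b')) \<in> near m"
        using m p h near_sym by blast
      then have "(\<psi> (inv h) b, b') \<in> near (max p m)"
        using near_mono[of m "max p m"] F_carrier[OF h(1)] b by auto
      moreover have "inv h \<in> F (max p m)"
        using p h(1) F_mono[of p "max p m"] by auto
      ultimately show ?thesis
        using b by (auto simp: quotient_near_def)
    qed
    then show "\<exists>m. (quotient_near l)\<inverse> \<subseteq> quotient_near m"
      by auto
  next
    fix l
    obtain p where p: "\<forall>h\<in>F l. \<forall>h'\<in>F l. h \<otimes> h' \<in> F p"
      using F_products by blast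
    obtain m where m: "\<forall>h\<in>F l. \<forall>x y. (x, y) \<in> near l \<longrightarrow> (\<psi> h x, \<psi> h y) \<in> near m"
      using action_near by blast
    define q where "q = max p (m + l)"
    have "(b'', b) \<in> quotient_near q" if bb': "(b'', b') \<in> quotient_near l" and bb: "(b', b) \<in> quotient_near l" for b'' b' b
    proof -
      obtain h where h: "h \<in> F l" "(\<psi> h b', b) \<in> near l" and b: "b' \<in> carrier Y" "b \<in> carrier Y"
        using bb by (auto simp: quotient_near_def)
      obtain h' where h': "h' \<in> F l" "(\<psi> h' b'', b') \<in> near l" and b'': "b'' \<in> carrier Y"
        using bb' by (auto simp: quotient_near_def)
      have "(\<psi> h (\<psi> h' b''), b) \<in> near (m + l)"
        using m h h' near_trans by blast
      then have "(\<psi> (h \<otimes> h') b'', b) \<in> near q"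
        using near_mono[of "m + l" q] F_carrier[OF h(1)] F_carrier[OF h'(1)] b''
        by (auto simp: composition_rule q_def)
      moreover have "h \<otimes> h' \<in> F q"
        using p h(1) h'(1) F_mono[of p q] by (auto simp: q_def)
      ultimately show ?thesis
        using b b'' by (auto simp: quotient_near_def)
    qed
    then have "quotient_near l O quotient_near l \<subseteq> quotient_near q"
      by auto
    then show "\<exists>q. quotient_near l O quotient_near l \<subseteq> quotient_near q"
      by blast
  qed
qed

lemma coarse_ents_quotient:
  "coarse_ents (coarse_quotient G (with_generator Y V) \<psi>) = {E. \<exists>l. E \<subseteq> quotient_near l}"
proof -
  let ?S = "{E. \<exists>l. E \<subseteq> near l} \<union> {{(\<psi> g y, y) | y. y \<in> carrier Y} | g. g \<in> carrier G}"
  obtain r where r: "\<one> \<in> F r"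
    using F_Union one_closed by blast
  have near: "near l \<subseteq> quotient_near (max l r)" for l
  proof (rule subrelI)
    fix x y
    assume xy: "(x, y) \<in> near l"
    then have "(x, y) \<in> near (max l r)"
      using near_mono[of l "max l r"] by auto
    moreover have "\<one> \<in> F (max l r)"
      using r F_mono[of r "max l r"] by auto
    ultimately show "(x, y) \<in> quotient_near (max l r)"
      using near_carrier[OF xy] by (auto simp: quotient_near_def intro!: bexI[of _ \<one>])
  qed
  have graph: "\<exists>l. {(\<psi> g y, y) | y. y \<in> carrier Y} \<subseteq> quotient_near l" if g: "g \<in> carrier G" for g
  proof -
    \<comment> \<open>The first component of a pair in the graph is \<open>\<psi> g y\<close>, and
      \<open>inv g\<close> carries it back to \<open>y\<close>.\<close>
    obtain l where "inv g \<in> F l"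
      using F_Union g inv_closed by blast
    then have "{(\<psi> g y, y) | y. y \<in> carrier Y} \<subseteq> quotient_near l"
      using g near_refl by (auto simp: quotient_near_def intro!: bexI[of _ "inv g"])
    then show ?thesis ..
  qed
  have "coarse_structure (carrier Y) hull ?S = {E. \<exists>l. E \<subseteq> quotient_near l}"
  proof (rule coarse_structure_hull_tower[OF coarse_structure_quotient_near])
    have "\<exists>l. E \<subseteq> quotient_near l" if "E \<subseteq> near l" for E l
      using order_trans[OF that near] by blast
    then show "?S \<subseteq> {E. \<exists>l. E \<subseteq> quotient_near l}"
      using graph by auto
  next
    fix \<D> l
    assume \<D>: "coarse_structure (carrier Y) \<D>" and S: "?S \<subseteq> \<D>"
    \<comment> \<open>A pair (b', b) of \<open>quotient_near l\<close> passes through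
      \<open>\<psi> h b'\<close>: the generator of \<open>inv h\<close> relates b' to it, and
      \<open>near l\<close> relates it to b. Only finitely many \<open>h\<close> occur, so the union
      stays coarse.\<close>
    have "(\<Union>h\<in>F l. {(\<psi> (inv h) y, y) | y. y \<in> carrier Y} O near l) \<in> \<D>"
      using S F_carrier inv_closed
      by (intro coarse_structure_UN[OF \<D> F_finite] coarse_structure_relcomp[OF \<D>]) blast+
    moreover have "quotient_near l \<subseteq> (\<Union>h\<in>F l. {(\<psi> (inv h) y, y) | y. y \<in> carrier Y} O near l)"
    proof (rule subrelI)
      fix b' b
      assume "(b', b) \<in> quotient_near l"
      then obtain h where h: "h \<in> F l" "(\<psi> h b', b) \<in> near l" and b': "b' \<in> carrier Y"
        by (auto simp: quotient_near_def)
      have "(b', \<psi> h b') \<in> {(\<psi> (inv h) y, y) | y. y \<in> carrier Y}"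
        using b' F_carrier[OF h(1)] by (auto intro!: exI[of _ "\<psi> h b'"])
      then show "(b', b) \<in> (\<Union>h\<in>F l. {(\<psi> (inv h) y, y) | y. y \<in> carrier Y} O near l)"
        using h by blast
    qed
    ultimately show "quotient_near l \<in> \<D>"
      by (rule coarse_structure_subset[OF \<D>])
  qed
  then show ?thesis
    by (simp add: coarse_quotient_def coarse_ents_with_generator)
qed

lemma quotient_simps [simp]:
  "carrier (coarse_quotient G (with_generator Y V) \<psi>) = carrier Y"
  "bounded_sets (coarse_quotient G (with_generator Y V) \<psi>) = bounded_sets Y"
  by (simp_all add: coarse_quotient_def)

lemma thickening_near_bounded: "B \<in> bounded_sets Y \<Longrightarrow> thickening (near l) B \<in> bounded_sets Y"
  using bcs near_coarse by (simp add: bornological_coarse_space_def)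

lemma bornological_coarse_space_quotient:
  "bornological_coarse_space (coarse_quotient G (with_generator Y V) \<psi>)"
proof -
  have "thickening E B \<in> bounded_sets Y" if B: "B \<in> bounded_sets Y" and E: "E \<subseteq> quotient_near l" for E B l
  proof -
    \<comment> \<open>Points related to \<open>B\<close> arise by thickening \<open>B\<close> by
      \<open>near l\<close> and translating by one of the finitely many
      \<open>inv h\<close>.\<close>
    have "thickening E B \<subseteq> (\<Union>h\<in>F l. \<psi> (inv h) ` thickening (near l) B)"
    proof
      fix x
      assume "x \<in> thickening E B"
      then obtain b where "b \<in> B" "(x, b) \<in> quotient_near l"
        using E by (auto simp: thickening_def)
      then obtain h where h: "h \<in> F l" and "(\<psi> h x, b) \<in> near l" and x: "x \<in> carrier Y"
        by (auto simp: quotient_near_def)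
      then have "\<psi> h x \<in> thickening (near l) B"
        using \<open>b \<in> B\<close> by (auto simp: thickening_def)
      moreover have "\<psi> (inv h) (\<psi> h x) = x"
        using F_carrier[OF h] x by simp
      ultimately show "x \<in> (\<Union>h\<in>F l. \<psi> (inv h) ` thickening (near l) B)"
        using h by (metis UN_I image_eqI)
    qed
    moreover have "(\<Union>h\<in>F l. \<psi> (inv h) ` thickening (near l) B) \<in> bounded_sets Y"
      using F_carrier by (intro bornology_UN[OF bornology F_finite] action_bounded thickening_near_bounded B) auto
    ultimately show ?thesis
      by (rule bornology_subset[OF bornology, rotated])
  qed
  then show ?thesis
    using bornology coarse_structure_quotient_near
    by (auto simp: bornological_coarse_space_def coarse_ents_quotient)
qed

text \<open>The group acts on the structure generated by \<open>V\<close> because a translate of a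
  power of \<open>V\<close> stays within some power of \<open>V\<close>.\<close>

lemma acts_by_bc_automorphisms_with_generator:
  "acts_by_bc_automorphisms G (with_generator Y V) \<psi>"
proof (rule acts_by_bc_automorphismsI)
  show "group_action G (carrier (with_generator Y V)) \<psi>"
    using group_action_axioms by simp
  have "thickening E B \<in> bounded_sets Y" if B: "B \<in> bounded_sets Y" and E: "E \<subseteq> near l" for E B l
    using E by (intro bornology_subset[OF bornology thickening_near_bounded[OF B, of l]])
      (auto simp: thickening_def)
  then show "bornological_coarse_space (with_generator Y V)"
    using bornology coarse_structure_near
    by (auto simp: bornological_coarse_space_def coarse_ents_with_generator)
next
  fix g
  assume g: "g \<in> carrier G"
  show "bornological_map (with_generator Y V) (with_generator Y V) (\<psi> g)"
    using action_bounded[OF g] by (simp add: bornological_map_def)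
  have "\<exists>m. map_prod (\<psi> g) (\<psi> g) ` E \<subseteq> near m" if E: "E \<subseteq> near l" for E l
  proof -
    obtain j where "g \<in> F j"
      using g F_Union by blast
    then obtain m where "\<forall>x y. (x, y) \<in> near l \<longrightarrow> (\<psi> g x, \<psi> g y) \<in> near m"
      using action_near by blast
    then have "map_prod (\<psi> g) (\<psi> g) ` E \<subseteq> near m"
      using E by auto
    then show ?thesis ..
  qed
  then show "controlled (with_generator Y V) (with_generator Y V) (\<psi> g)"
    by (auto simp: controlled_def coarse_ents_with_generator)
qed

section \<open>The semidirect product\<close>

abbreviation "cover \<equiv> semidirect_quotient G (with_generator Y V) \<psi>"

abbreviation "cover_action \<equiv> diagonal_action G (with_generator Y V) \<psi>"

text \<open>
  Translating (g, y) to the sheet over the unit, every invariant entourage has this form.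
\<close>

definition invariant_rel :: "('g \<Rightarrow> 'a \<Rightarrow> 'a \<Rightarrow> bool) \<Rightarrow> (('g \<times> 'a) \<times> ('g \<times> 'a)) set" where
  "invariant_rel Q = {((g', y'), (g, y)). g' \<in> carrier G \<and> y' \<in> carrier Y \<and> g \<in> carrier G \<and> y \<in> carrier Y \<and>
     Q (inv g \<otimes> g') (\<psi> (inv g) y') (\<psi> (inv g) y)}"

text \<open>Neither \<open>inv g \<otimes> g'\<close> nor the translates of the two points by
  \<open>inv g\<close> change when both points are moved by the diagonal action. The opposite
  inclusion follows by applying this to the inverse element.\<close>

lemma invariant_entourage_invariant_rel: "invariant_entourage G cover_action (invariant_rel Q)"
proof -
  have sub: "map_prod (cover_action k) (cover_action k) ` invariant_rel Q \<subseteq> invariant_rel Q"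
    if k: "k \<in> carrier G" for k
  proof -
    have "inv (k \<otimes> g) \<otimes> (k \<otimes> g') = inv g \<otimes> g'" if "g \<in> carrier G" "g' \<in> carrier G" for g g'
      using that k by (simp add: inv_mult_group m_assoc)
    moreover have "\<psi> (inv (k \<otimes> g)) (\<psi> k y) = \<psi> (inv g) y" if "g \<in> carrier G" "y \<in> carrier Y" for g y
      using that k by (simp add: inv_mult_group composition_rule)
    ultimately show ?thesis
      using k by (auto simp: invariant_rel_def diagonal_action_def)
  qed
  have "p \<in> map_prod (cover_action k) (cover_action k) ` invariant_rel Q"
    if k: "k \<in> carrier G" and p: "p \<in> invariant_rel Q" for k p
  proof (rule image_eqI)
    show "map_prod (cover_action (inv k)) (cover_action (inv k)) p \<in> invariant_rel Q"
      using sub[of "inv k"] k p by blast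
    show "p = map_prod (cover_action k) (cover_action k) (map_prod (cover_action (inv k)) (cover_action (inv k)) p)"
      using p k by (auto simp: invariant_rel_def diagonal_action_def)
  qed
  then show ?thesis
    unfolding invariant_entourage_def using sub by blast
qed

text \<open>\<open>h\<close> is the change of sheet \<open>inv g \<otimes> g'\<close>, and both
  points are compared after translation by \<open>inv g\<close>, from the sheet of the second point.
  With \<open>f (g, y) = \<psi> (inv g) y\<close> one has
  \<open>\<psi> (inv g) y' = \<psi> h (f (g', y'))\<close>, so this is \<open>quotient_near\<close>
  on the base points with \<open>h\<close> remembered.\<close>

definition cover_near :: "nat \<Rightarrow> (('g \<times> 'a) \<times> ('g \<times> 'a)) set" where
  "cover_near l = invariant_rel (\<lambda>h x y. h \<in> F l \<and> (x, y) \<in> near l)"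

lemma cover_near_iff: "((g', y'), (g, y)) \<in> cover_near l \<longleftrightarrow>
    g' \<in> carrier G \<and> y' \<in> carrier Y \<and> g \<in> carrier G \<and> y \<in> carrier Y \<and>
    inv g \<otimes> g' \<in> F l \<and> (\<psi> (inv g) y', \<psi> (inv g) y) \<in> near l"
  by (simp add: cover_near_def invariant_rel_def)

lemma coarse_structure_cover_near: "coarse_structure (carrier G \<times> carrier Y) {E. \<exists>l. E \<subseteq> cover_near l}"
proof -
  obtain r where r: "\<one> \<in> F r"
    using F_Union one_closed by blast
  \<comment> \<open>Inverses and compositions alter the sheet in which points are compared. The
    transition is the action of the change of sheet, which comes from a finite set fixed in advance,
    so \<open>action_near\<close> applies.\<close>
  have change: "\<psi> (inv g \<otimes> g') (\<psi> (inv g') y) = \<psi> (inv g) y"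
    if "g \<in> carrier G" "g' \<in> carrier G" "y \<in> carrier Y" for g g' y
    using that by (simp add: composition_rule)
  show ?thesis
  proof (rule coarse_structure_tower)
    show "cover_near l \<subseteq> cover_near m" if "l \<le> m" for l m
      using F_mono[OF that] near_mono[OF that] by (auto simp: cover_near_iff)
    show "cover_near l \<subseteq> (carrier G \<times> carrier Y) \<times> (carrier G \<times> carrier Y)" for l
      by (auto simp: cover_near_iff)
    show "Id_on (carrier G \<times> carrier Y) \<subseteq> cover_near r"
      using r near_refl by (auto simp: cover_near_iff)
  next
    fix l
    obtain p where p: "\<forall>h\<in>F l. inv h \<in> F p"
      using F_inverses by blast
    obtain m where m: "\<forall>h\<in>F p. \<forall>x y. (x, y) \<in> near l \<longrightarrow> (\<psi> h x, \<psi> h y) \<in> near m"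
      using action_near by blast
    have "((g, y), (g', y')) \<in> cover_near (max p m)" if "((g', y'), (g, y)) \<in> cover_near l" for g g' y y'
    proof -
      have *: "g' \<in> carrier G" "y' \<in> carrier Y" "g \<in> carrier G" "y \<in> carrier Y"
        "inv g \<otimes> g' \<in> F l" "(\<psi> (inv g) y', \<psi> (inv g) y) \<in> near l"
        using that by (simp_all add: cover_near_iff)
      have "inv (inv g \<otimes> g') \<in> F p"
        using p *(5) by blast
      then have h: "inv g' \<otimes> g \<in> F p"
        using * by (simp add: inv_mult_group)
      then have "(\<psi> (inv g' \<otimes> g) (\<psi> (inv g) y), \<psi> (inv g' \<otimes> g) (\<psi> (inv g) y')) \<in> near m"
        using m near_sym[OF *(6)] by blast
      then have "(\<psi> (inv g') y, \<psi> (inv g') y') \<in> near m"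
        using * by (simp add: change)
      then show ?thesis
        using * h near_mono[of m "max p m"] F_mono[of p "max p m"] by (auto simp: cover_near_iff)
    qed
    then show "\<exists>m. (cover_near l)\<inverse> \<subseteq> cover_near m"
      by (intro exI[of _ "max p m"]) auto
  next
    fix l
    obtain p where p: "\<forall>h\<in>F l. \<forall>h'\<in>F l. h \<otimes> h' \<in> F p"
      using F_products by blast
    obtain m where m: "\<forall>h\<in>F l. \<forall>x y. (x, y) \<in> near l \<longrightarrow> (\<psi> h x, \<psi> h y) \<in> near m"
      using action_near by blast
    define q where "q = max p (m + l)"
    have "((g'', y''), (g, y)) \<in> cover_near q"
      if 1: "((g'', y''), (g', y')) \<in> cover_near l" and 2: "((g', y'), (g, y)) \<in> cover_near l"
      for g'' g' g y'' y' y
    proof -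
      have *: "g' \<in> carrier G" "y' \<in> carrier Y" "g \<in> carrier G" "y \<in> carrier Y"
        "inv g \<otimes> g' \<in> F l" "(\<psi> (inv g) y', \<psi> (inv g) y) \<in> near l"
        "g'' \<in> carrier G" "y'' \<in> carrier Y" "inv g' \<otimes> g'' \<in> F l" "(\<psi> (inv g') y'', \<psi> (inv g') y') \<in> near l"
        using 1 2 by (simp_all add: cover_near_iff)
      have "(inv g \<otimes> g') \<otimes> (inv g' \<otimes> g'') \<in> F p"
        using p * by blast
      then have "inv g \<otimes> g'' \<in> F q"
        using * F_mono[of p q] by (auto simp: m_assoc q_def)
      moreover have "(\<psi> (inv g \<otimes> g') (\<psi> (inv g') y''), \<psi> (inv g \<otimes> g') (\<psi> (inv g') y')) \<in> near m"
        using m * by blast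
      then have "(\<psi> (inv g) y'', \<psi> (inv g) y') \<in> near m"
        using * by (simp only: change)
      then have "(\<psi> (inv g) y'', \<psi> (inv g) y) \<in> near q"
        using near_trans[OF _ *(6)] near_mono[of "m + l" q] by (auto simp: q_def)
      ultimately show ?thesis
        using * by (simp add: cover_near_iff)
    qed
    then have "cover_near l O cover_near l \<subseteq> cover_near q"
      by auto
    then show "\<exists>q. cover_near l O cover_near l \<subseteq> cover_near q"
      by blast
  qed
qed

lemma coarse_ents_cover: "coarse_ents cover = {E. \<exists>l. E \<subseteq> cover_near l}"
proof -
  let ?ent = "semidirect_ent G (with_generator Y V) \<psi>"
  let ?graph = "\<lambda>h. {(right_action G (with_generator Y V) h a, a) | a. a \<in> carrier G \<times> carrier Y}"
  let ?C = "coarse_structure (carrier G \<times> carrier Y)"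
  let ?T = "{?ent W | W. \<exists>l. W \<subseteq> near l}"
  let ?S = "?C hull ?T \<union> {?graph h | h. h \<in> carrier G}"
  have right: "right_action G (with_generator Y V) h (g, y) = (g \<otimes> inv h, y)"
    if "g \<in> carrier G" "y \<in> carrier Y" for h g y
    using that by (simp add: right_action_def)
  obtain r where r: "\<one> \<in> F r"
    using F_Union one_closed by blast
  have ent: "?ent W \<subseteq> cover_near (max l r)" if W: "W \<subseteq> near l" for W l
    using order_trans[OF W near_mono[of l "max l r"]] subsetD[OF F_mono[of r "max l r"] r]
    by (auto simp: semidirect_ent_def cover_near_iff)
  have graph: "\<exists>l. ?graph h \<subseteq> cover_near l" if h: "h \<in> carrier G" for h
  proof -
    obtain l where "inv h \<in> F l"
      using F_Union h inv_closed by blast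
    then have "?graph h \<subseteq> cover_near l"
      using h near_refl by (auto simp: right cover_near_iff)
    then show ?thesis ..
  qed
  have "?C hull ?S = {E. \<exists>l. E \<subseteq> cover_near l}"
  proof (rule coarse_structure_hull_tower[OF coarse_structure_cover_near])
    have "\<exists>m. ?ent W \<subseteq> cover_near m" if "W \<subseteq> near l" for W l
      using ent[OF that] by meson
    then have "?T \<subseteq> {E. \<exists>l. E \<subseteq> cover_near l}"
      by auto
    then have "?C hull ?T \<subseteq> {E. \<exists>l. E \<subseteq> cover_near l}"
      using coarse_structure_cover_near by (rule hull_minimal)
    moreover have "{?graph h | h. h \<in> carrier G} \<subseteq> {E. \<exists>l. E \<subseteq> cover_near l}"
      using graph by blast
    ultimately show "?S \<subseteq> {E. \<exists>l. E \<subseteq> cover_near l}"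
      by (rule Un_least)
  next
    fix \<D> l
    assume \<D>: "?C \<D>" and S: "?S \<subseteq> \<D>"
    have "?ent (near l) \<in> \<D>"
      using S hull_inc[of "?ent (near l)" ?T ?C] by blast
    then have "(\<Union>h\<in>F l. ?graph (inv h) O ?ent (near l)) \<in> \<D>"
      using S F_carrier inv_closed
      by (intro coarse_structure_UN[OF \<D> F_finite] coarse_structure_relcomp[OF \<D>]) blast+
    \<comment> \<open>Right multiplication leads from the sheet \<open>g'\<close> to the sheet
      \<open>g\<close> with \<open>y'\<close> fixed; the points then lie in one sheet and are
      related by a generator over \<open>near l\<close>. The inverse in
      \<open>?graph (inv h)\<close> undoes the one in \<open>right_action\<close>.\<close>
    moreover have "cover_near l \<subseteq> (\<Union>h\<in>F l. ?graph (inv h) O ?ent (near l))"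
    proof (rule subrelI)
      fix a' a
      assume aa: "(a', a) \<in> cover_near l"
      obtain g' y' g y where a: "a' = (g', y')" "a = (g, y)"
        by (metis surj_pair)
      have *: "g' \<in> carrier G" "y' \<in> carrier Y" "g \<in> carrier G" "y \<in> carrier Y"
        "inv g \<otimes> g' \<in> F l" "(\<psi> (inv g) y', \<psi> (inv g) y) \<in> near l"
        using aa by (simp_all add: cover_near_iff a)
      have "(a', (g, y')) \<in> ?graph (inv (inv g \<otimes> g'))"
        using * right[of g y' "inv (inv g \<otimes> g')"] by (auto simp: a intro!: exI[of _ g])
      moreover have "((g, y'), a) \<in> ?ent (near l)"
        using * by (simp add: semidirect_ent_def a)
      ultimately show "(a', a) \<in> (\<Union>h\<in>F l. ?graph (inv h) O ?ent (near l))"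
        using *(5) by blast
    qed
    ultimately show "cover_near l \<in> \<D>"
      by (rule coarse_structure_subset[OF \<D>])
  qed
  then show ?thesis
    by (simp add: semidirect_quotient_def coarse_quotient_def semidirect_def coarse_ents_with_generator)
qed

lemma carrier_cover [simp]: "carrier cover = carrier G \<times> carrier Y"
  by (simp add: semidirect_quotient_def coarse_quotient_def semidirect_def)

lemma bounded_sets_cover: "bounded_sets cover =
    {K. \<exists>S B. S \<subseteq> carrier G \<and> finite S \<and> B \<in> bounded_sets Y \<and> K \<subseteq> S \<times> B}"
  using product_bornology_hull[OF bornology, of "carrier G"]
  by (simp add: semidirect_quotient_def coarse_quotient_def semidirect_def)

lemma bornological_coarse_space_cover: "bornological_coarse_space cover"
proof -
  have "thickening E K \<in> bounded_sets cover" if K: "K \<in> bounded_sets cover" and E: "E \<subseteq> cover_near l" for E K l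
  proof -
    obtain S B where S: "S \<subseteq> carrier G" "finite S" and B: "B \<in> bounded_sets Y" and KS: "K \<subseteq> S \<times> B"
      using K by (auto simp: bounded_sets_cover)
    \<comment> \<open>The sheets reached from \<open>S\<close> differ by right factors in
      \<open>F l\<close>. For a starting sheet \<open>g\<close>, the thickening takes place after
      translation by \<open>inv g\<close> and is then translated back.\<close>
    let ?S = "(\<lambda>(g, h). g \<otimes> h) ` (S \<times> F l)"
    let ?B = "\<Union>g\<in>S. \<psi> g ` thickening (near l) (\<psi> (inv g) ` B)"
    have "?B \<in> bounded_sets Y"
      using S by (intro bornology_UN[OF bornology] action_bounded thickening_near_bounded B) auto
    moreover have "finite ?S" "?S \<subseteq> carrier G"
      using S F_finite F_carrier by auto
    moreover have "thickening E K \<subseteq> ?S \<times> ?B"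
    proof
      fix a'
      assume "a' \<in> thickening E K"
      then obtain a where a: "a \<in> K" "(a', a) \<in> cover_near l"
        using E by (auto simp: thickening_def)
      obtain g' y' g y where aa: "a' = (g', y')" "a = (g, y)"
        by (metis surj_pair)
      have *: "g' \<in> carrier G" "y' \<in> carrier Y" "g \<in> carrier G" "y \<in> carrier Y"
        "inv g \<otimes> g' \<in> F l" "(\<psi> (inv g) y', \<psi> (inv g) y) \<in> near l"
        using a(2) by (simp_all add: cover_near_iff aa)
      have gy: "g \<in> S" "y \<in> B"
        using a(1) KS by (auto simp: aa)
      have "g' = g \<otimes> (inv g \<otimes> g')"
        using * by simp
      then have "g' \<in> ?S"
        using gy *(5) by (intro image_eqI[of _ _ "(g, inv g \<otimes> g')"]) auto
      moreover have "\<psi> (inv g) y' \<in> thickening (near l) (\<psi> (inv g) ` B)"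
        using *(6) gy by (auto simp: thickening_def)
      then have "y' \<in> \<psi> g ` thickening (near l) (\<psi> (inv g) ` B)"
        using * by (metis action_inv(2) image_eqI)
      ultimately show "a' \<in> ?S \<times> ?B"
        using gy by (auto simp: aa)
    qed
    ultimately show ?thesis
      unfolding bounded_sets_cover mem_Collect_eq by blast
  qed
  then have "\<forall>E\<in>coarse_ents cover. \<forall>K\<in>bounded_sets cover. thickening E K \<in> bounded_sets cover"
    unfolding coarse_ents_cover mem_Collect_eq by blast
  moreover have "bornology (carrier cover) (bounded_sets cover)"
    unfolding bounded_sets_cover carrier_cover by (rule product_bornology[OF bornology])
  moreover have "coarse_structure (carrier cover) (coarse_ents cover)"
    unfolding coarse_ents_cover carrier_cover by (rule coarse_structure_cover_near)
  ultimately show ?thesis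
    unfolding bornological_coarse_space_def by blast
qed

lemma group_action_cover: "group_action G (carrier cover) cover_action"
proof -
  have "cover_action = (\<lambda>h. restrict (\<lambda>(g, y). (h \<otimes> g, \<psi> h y)) (carrier cover))"
    by (auto simp: diagonal_action_def)
  moreover have "group_action G (carrier cover) (\<lambda>h. restrict (\<lambda>(g, y). (h \<otimes> g, \<psi> h y)) (carrier cover))"
    using is_group by (intro group_action_restrictI) (auto simp: m_assoc composition_rule)
  ultimately show ?thesis
    by simp
qed

text \<open>Distances are measured after translation to the sheet over the unit, so every
  \<open>cover_near l\<close> is invariant even if \<open>V\<close> is not; these sets form a base
  of invariant entourages.\<close>

lemma G_bornological_coarse_space_cover: "G_bornological_coarse_space G cover cover_action"
proof -
  have invariant: "invariant_entourage G cover_action (cover_near l)" for l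
    unfolding cover_near_def by (rule invariant_entourage_invariant_rel)
  have "acts_by_bc_automorphisms G cover cover_action"
  proof (rule acts_by_bc_automorphismsI[OF group_action_cover bornological_coarse_space_cover])
    fix g
    assume g: "g \<in> carrier G"
    have "map_prod (cover_action g) (cover_action g) ` E \<subseteq> cover_near l" if E: "E \<subseteq> cover_near l" for E l
      using image_mono[OF E] invariant[of l] g unfolding invariant_entourage_def by metis
    then show "controlled cover cover (cover_action g)"
      unfolding controlled_def coarse_ents_cover by blast
    show "bornological_map cover cover (cover_action g)"
      unfolding bornological_map_def
    proof
      fix K
      assume "K \<in> bounded_sets cover"
      then obtain S B where S: "S \<subseteq> carrier G" "finite S" and B: "B \<in> bounded_sets Y" and K: "K \<subseteq> S \<times> B"
        by (auto simp: bounded_sets_cover)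
      have "cover_action g ` K \<subseteq> ((\<otimes>) g ` S) \<times> (\<psi> g ` B)"
        using K S bornology_carrier[OF bornology B] by (force simp: diagonal_action_def)
      moreover have "(\<otimes>) g ` S \<subseteq> carrier G" "finite ((\<otimes>) g ` S)"
        using S g by auto
      ultimately show "cover_action g ` K \<in> bounded_sets cover"
        using action_bounded[OF g B] unfolding bounded_sets_cover mem_Collect_eq by blast
    qed
  qed
  moreover have "\<forall>U\<in>coarse_ents cover. \<exists>V\<in>coarse_ents cover. invariant_entourage G cover_action V \<and> U \<subseteq> V"
    unfolding coarse_ents_cover using invariant by blast
  ultimately show ?thesis
    using bornological_coarse_space_cover by (simp add: G_bornological_coarse_space_def)
qed

section \<open>The branched covering\<close>

text \<open>\<open>thick\<close> deals with steps of \<open>V\<close> and \<open>invariant\<close>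
  with translations; together they make \<open>\<Z>\<close> a big family for the quotient.
  \<open>free\<close> is stated for every power of \<open>V\<close>, since comparing two lifts
  concatenates chains. Prescribing \<open>f\<close> on the carrier lets the explicit map on triples
  be inserted later.\<close>

theorem branched_coarse_covering_cover:
  assumes nonempty: "\<Z> \<noteq> {}" and sub: "\<And>Z. Z \<in> \<Z> \<Longrightarrow> Z \<subseteq> carrier Y"
    and directed: "\<And>Z1 Z2. Z1 \<in> \<Z> \<Longrightarrow> Z2 \<in> \<Z> \<Longrightarrow> \<exists>Z3\<in>\<Z>. Z1 \<union> Z2 \<subseteq> Z3"
    and thick: "\<And>Z. Z \<in> \<Z> \<Longrightarrow> \<exists>Z'\<in>\<Z>. thickening V Z \<subseteq> Z'"
    and invariant: "\<And>Z g. Z \<in> \<Z> \<Longrightarrow> g \<in> carrier G \<Longrightarrow> \<psi> g ` Z \<subseteq> Z"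
    and free: "\<And>g l. g \<in> carrier G \<Longrightarrow> g \<noteq> \<one> \<Longrightarrow>
      \<exists>Z\<in>\<Z>. \<forall>y\<in>carrier Y. (\<psi> g y, y) \<in> V ^^ l \<longrightarrow> y \<in> Z"
    and f: "\<And>g y. g \<in> carrier G \<Longrightarrow> y \<in> carrier Y \<Longrightarrow> f (g, y) = \<psi> (inv g) y"
  shows "branched_coarse_covering G cover cover_action
    (coarse_quotient G (with_generator Y V) \<psi>) \<Z> f"
proof -
  let ?B = "coarse_quotient G (with_generator Y V) \<psi>"
  have thick_near: "\<exists>Z'\<in>\<Z>. thickening (near l) Z \<subseteq> Z'" if "Z \<in> \<Z>" for Z l
  proof (induction l)
    case 0
    show ?case
      using that by (intro bexI[of _ Z]) (auto simp: thickening_def near_def)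
  next
    case (Suc l)
    then obtain Z' where Z': "Z' \<in> \<Z>" "thickening (near l) Z \<subseteq> Z'"
      by blast
    then obtain Z'' where Z'': "Z'' \<in> \<Z>" "thickening V Z' \<subseteq> Z''"
      using thick by blast
    have "thickening (near (Suc l)) Z \<subseteq> thickening V Z'"
    proof
      fix x
      assume "x \<in> thickening (near (Suc l)) Z"
      then obtain z where z: "z \<in> Z" "x \<in> carrier Y" "z \<in> carrier Y" "(x, z) \<in> V ^^ Suc l"
        by (auto simp: thickening_def near_def)
      obtain y where y: "(x, y) \<in> V" "(y, z) \<in> V ^^ l"
        using relpow_Suc_D2[OF z(4)] by blast
      then have "(y, z) \<in> near l"
        using coarse_structure_carrier[OF coarse V_coarse] z by (auto simp: near_def)
      then show "x \<in> thickening V Z'"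
        using y z Z' by (auto simp: thickening_def)
    qed
    then show ?case
      using Z'' by blast
  qed
  have directed_finite: "\<exists>Z0\<in>\<Z>. \<forall>s\<in>S. Z s \<subseteq> Z0" if "finite S" "\<And>s. s \<in> S \<Longrightarrow> Z s \<in> \<Z>" for S :: "'g set" and Z
    using that
  proof (induction S rule: finite_induct)
    case empty
    then show ?case
      using nonempty by blast
  next
    case (insert s S)
    then obtain Z0 where Z0: "Z0 \<in> \<Z>" "\<forall>s\<in>S. Z s \<subseteq> Z0"
      by auto
    then obtain Z1 where "Z1 \<in> \<Z>" "Z s \<union> Z0 \<subseteq> Z1"
      using directed[of "Z s" Z0] insert.prems by auto
    then show ?case
      using Z0 by (intro bexI[of _ Z1]) auto
  qed

  text \<open>If two group elements bring \<^term>\<open>b'\<close> close to \<^term>\<open>b\<close>, their quotient moves a point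
    near \<^term>\<open>b\<close> only little, which freeness forbids outside a member of the family.\<close>
  have "\<exists>Z\<in>\<Z>. \<forall>h\<in>F l. \<forall>h'\<in>F l. \<forall>b'\<in>carrier Y. \<forall>b.
      (\<psi> h b', b) \<in> near l \<longrightarrow> (\<psi> h' b', b) \<in> near l \<longrightarrow> h \<noteq> h' \<longrightarrow> b \<in> Z" for l
  proof -
    \<comment> \<open>There are finitely many nontrivial quotients, so one member of the family
      controls them all. The exponent \<open>l + l\<close> used for them joins the chain from
      \<open>\<psi> h b'\<close> to \<open>b\<close> with the reversed chain from
      \<open>\<psi> h' b'\<close>.\<close>
    define S where "S = (\<lambda>(h, h'). h \<otimes> inv h') ` (F l \<times> F l) - {\<one>}"
    have S: "finite S" "S \<subseteq> carrier G - {\<one>}"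
      using F_finite F_carrier by (auto simp: S_def)
    then have "\<forall>s\<in>S. \<exists>Z\<in>\<Z>. \<forall>y\<in>carrier Y. (\<psi> s y, y) \<in> V ^^ (l + l) \<longrightarrow> y \<in> Z"
      using free by blast
    then obtain Z where Z: "\<And>s. s \<in> S \<Longrightarrow> Z s \<in> \<Z>"
        "\<And>s y. s \<in> S \<Longrightarrow> y \<in> carrier Y \<Longrightarrow> (\<psi> s y, y) \<in> V ^^ (l + l) \<Longrightarrow> y \<in> Z s"
      by metis
    obtain Z0 where Z0: "Z0 \<in> \<Z>" "\<And>s. s \<in> S \<Longrightarrow> Z s \<subseteq> Z0"
      using directed_finite[of S Z] S(1) Z(1) by blast
    \<comment> \<open>Freeness locates \<open>\<psi> h' b'\<close> and not \<open>b\<close>; one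
      more thickening reaches \<open>b\<close>.\<close>
    obtain Z1 where Z1: "Z1 \<in> \<Z>" "thickening (near l) Z0 \<subseteq> Z1"
      using thick_near[OF Z0(1)] by blast
    have "b \<in> Z1" if h: "h \<in> F l" "h' \<in> F l" "h \<noteq> h'" and b': "b' \<in> carrier Y"
      and near: "(\<psi> h b', b) \<in> near l" "(\<psi> h' b', b) \<in> near l" for h h' b' b
    proof -
      have hG: "h \<in> carrier G" "h' \<in> carrier G"
        using h F_carrier by auto
      have "h \<otimes> inv h' \<noteq> \<one>"
        using h(3) hG by (metis inv_closed inv_equality inv_inv)
      then have s: "h \<otimes> inv h' \<in> S"
        using h by (auto simp: S_def)
      have "\<psi> (h \<otimes> inv h') (\<psi> h' b') = \<psi> h b'"
        using hG b' by (simp add: composition_rule)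
      moreover have "(\<psi> h b', \<psi> h' b') \<in> near (l + l)"
        using near near_trans near_sym by blast
      ultimately have "\<psi> h' b' \<in> Z (h \<otimes> inv h')"
        using Z(2)[OF s] hG b' by (simp add: near_def)
      then have "b \<in> thickening (near l) Z0"
        using Z0(2)[OF s] near_sym[OF near(2)] by (auto simp: thickening_def)
      then show ?thesis
        using Z1 by blast
    qed
    then show ?thesis
      using Z1(1) by blast
  qed
  then obtain Z where Z: "\<And>l. Z l \<in> \<Z>"
      "\<And>l h h' b' b. h \<in> F l \<Longrightarrow> h' \<in> F l \<Longrightarrow> b' \<in> carrier Y \<Longrightarrow>
        (\<psi> h b', b) \<in> near l \<Longrightarrow> (\<psi> h' b', b) \<in> near l \<Longrightarrow> h \<noteq> h' \<Longrightarrow> b \<in> Z l"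
    by metis
  \<comment> \<open>\<open>invariant_rel Q\<close> will be the entourage \<open>P\<close>. It has to
    serve all coarse entourages at once, so \<open>l\<close> is quantified inside.\<close>
  define Q where "Q h x b \<longleftrightarrow> (\<exists>l. h \<in> F l \<and> (x, b) \<in> near l \<and> b \<notin> Z l)" for h x b
  \<comment> \<open>At the larger of the two levels both elements and both chains are available, and
    \<open>b\<close> avoids the member belonging to that level, so different elements would
    contradict \<open>Z(2)\<close>.\<close>
  have unique: "h = h'" if Q: "Q h (\<psi> h b') b" "Q h' (\<psi> h' b') b" and b': "b' \<in> carrier Y" for h h' b' b
  proof -
    obtain l l' where l: "h \<in> F l" "(\<psi> h b', b) \<in> near l" "b \<notin> Z l"
      and l': "h' \<in> F l'" "(\<psi> h' b', b) \<in> near l'" "b \<notin> Z l'"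
      using Q by (auto simp: Q_def)
    show ?thesis
    proof (cases "l \<le> l'")
      case True
      then show ?thesis
        using Z(2)[of h l' h' b' b] l l' b' F_mono[of l l'] near_mono[of l l'] by blast
    next
      case False
      then show ?thesis
        using Z(2)[of h l h' b' b] l l' b' F_mono[of l' l] near_mono[of l' l] by auto
    qed
  qed
  have P: "((g', y'), (g, y)) \<in> invariant_rel Q \<longleftrightarrow> g' \<in> carrier G \<and> y' \<in> carrier Y \<and> g \<in> carrier G \<and>
      y \<in> carrier Y \<and> Q (inv g \<otimes> g') (\<psi> (inv g) y') (f (g, y))" for g' y' g y
    using f by (auto simp: invariant_rel_def)
  \<comment> \<open>This links the condition on a pair upstairs to its base points: the change of
    sheet is the group element that brings the first base point close to the second.\<close>
  have translate: "\<psi> (inv g) y' = \<psi> (inv g \<otimes> g') (f (g', y'))"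
    if "g \<in> carrier G" "g' \<in> carrier G" "y' \<in> carrier Y" for g g' y'
    using that f by (simp add: composition_rule)

  have covering: "\<exists>!a'. a' \<in> carrier cover \<and> f a' = b' \<and> (a', a) \<in> invariant_rel Q"
    if bb: "(b', b) \<in> quotient_near l" and b: "b \<notin> Z l" and a: "a \<in> carrier cover" "f a = b" for b' b l a
  proof -
    obtain g y where gy: "a = (g, y)" "g \<in> carrier G" "y \<in> carrier Y"
      using a by auto
    obtain h where h: "h \<in> F l" "(\<psi> h b', b) \<in> near l" and b': "b' \<in> carrier Y"
      using bb by (auto simp: quotient_near_def)
    note hG = F_carrier[OF h(1)]
    have Q: "Q h (\<psi> h b') b"
      using h b by (auto simp: Q_def)
    show ?thesis
    proof (rule ex1I)
      \<comment> \<open>The change of sheet \<open>h\<close> fixes the sheet, and in the sheet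
        \<open>g \<otimes> h\<close> the point over \<open>b'\<close> is its translate by
        \<open>g \<otimes> h\<close>.\<close>
      let ?a = "(g \<otimes> h, \<psi> (g \<otimes> h) b')"
      have "f ?a = b'"
        using gy hG b' f[of "g \<otimes> h"] by simp
      moreover from this have "\<psi> (inv g) (\<psi> (g \<otimes> h) b') = \<psi> h b'"
        using gy hG b' translate[of g "g \<otimes> h" "\<psi> (g \<otimes> h) b'"] by simp
      ultimately show "?a \<in> carrier cover \<and> f ?a = b' \<and> (?a, a) \<in> invariant_rel Q"
        using gy hG b' Q a by (simp add: P)
    next
      fix a'
      assume a': "a' \<in> carrier cover \<and> f a' = b' \<and> (a', a) \<in> invariant_rel Q"
      then obtain g' y' where g': "a' = (g', y')" "g' \<in> carrier G" "y' \<in> carrier Y"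
        by auto
      have "Q (inv g \<otimes> g') (\<psi> (inv g \<otimes> g') b') b"
        using a' gy g' a translate[of g g' y'] by (auto simp: P)
      then have "inv g \<otimes> g' = h"
        using unique Q b' by blast
      then have "g' = g \<otimes> h"
        using gy g' by (metis cancel(2))
      moreover have "\<psi> g' b' = y'"
        using a' g' f by auto
      ultimately show "a' = (g \<otimes> h, \<psi> (g \<otimes> h) b')"
        using g' by simp
    qed
  qed
  \<comment> \<open>A pair in \<open>invariant_rel Q\<close> may owe its membership to an
    arbitrarily high level. Over \<open>E\<close> and outside \<open>Z l\<close>, its base points
    are also related by an element of \<open>F l\<close>; uniqueness identifies the two elements and
    bounds the pair by \<open>cover_near l\<close>.\<close>
  have lift: "invariant_rel Q \<inter> {(a', a) \<in> carrier cover \<times> carrier cover.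
      (f a', f a) \<in> E \<inter> (carrier Y \<times> (carrier Y - Z l))} \<subseteq> cover_near l"
    if E: "E \<subseteq> quotient_near l" for E l
  proof (rule subrelI, elim IntE)
    fix a' a
    assume PP: "(a', a) \<in> invariant_rel Q" and EE: "(a', a) \<in> {(a', a) \<in> carrier cover \<times> carrier cover.
      (f a', f a) \<in> E \<inter> (carrier Y \<times> (carrier Y - Z l))}"
    obtain g' y' g y where a: "a' = (g', y')" "a = (g, y)"
      by (metis surj_pair)
    have *: "g' \<in> carrier G" "y' \<in> carrier Y" "g \<in> carrier G" "y \<in> carrier Y"
      "Q (inv g \<otimes> g') (\<psi> (inv g) y') (f (g, y))"
      using PP by (simp_all add: P a)
    have E': "(f (g', y'), f (g, y)) \<in> quotient_near l" "f (g, y) \<notin> Z l"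
      using EE E by (auto simp: a)
    then obtain h where h: "h \<in> F l" "(\<psi> h (f (g', y')), f (g, y)) \<in> near l" and "f (g', y') \<in> carrier Y"
      by (auto simp: quotient_near_def)
    moreover from this have "Q h (\<psi> h (f (g', y'))) (f (g, y))"
      using E' by (auto simp: Q_def)
    moreover have "Q (inv g \<otimes> g') (\<psi> (inv g \<otimes> g') (f (g', y'))) (f (g, y))"
      using * by (simp add: translate)
    ultimately have "inv g \<otimes> g' = h"
      using unique by blast
    then show "(a', a) \<in> cover_near l"
      using * h translate[of g g' y'] f[of g y] by (simp add: a cover_near_iff)
  qed
  have small: "U \<inter> (carrier cover \<times> {a \<in> carrier cover. f a \<in> carrier Y - Z l}) \<subseteq> invariant_rel Q"
    if U: "U \<subseteq> cover_near l" for U l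
    using U f by (auto simp: P Q_def cover_near_iff subset_iff intro!: exI[of _ l])

  \<comment> \<open>A pair in the quotient splits into a translation and a step of
    \<open>near l\<close>; \<open>Z''\<close> absorbs the step by its choice and the translation by
    its invariance.\<close>
  have "thickening E Z' \<subseteq> Z''" if Z': "Z' \<in> \<Z>" and E: "E \<subseteq> quotient_near l" and
    Z'': "Z'' \<in> \<Z>" "thickening (near l) Z' \<subseteq> Z''" for E l Z' Z''
  proof
    fix x
    assume "x \<in> thickening E Z'"
    then obtain z where "z \<in> Z'" "(x, z) \<in> quotient_near l"
      using E by (auto simp: thickening_def)
    then obtain h where h: "h \<in> F l" "x \<in> carrier Y" "\<psi> h x \<in> thickening (near l) Z'"
      by (auto simp: quotient_near_def thickening_def)
    then have "\<psi> (inv h) (\<psi> h x) \<in> Z''"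
      using invariant[OF Z''(1), of "inv h"] Z''(2) F_carrier inv_closed by blast
    then show "x \<in> Z''"
      using h F_carrier by simp
  qed
  then have "\<exists>Z''\<in>\<Z>. thickening E Z' \<subseteq> Z''" if "Z' \<in> \<Z>" "E \<subseteq> quotient_near l" for E l Z'
    using that thick_near[of Z' l] by meson
  then have "\<forall>Z\<in>\<Z>. \<forall>E\<in>coarse_ents ?B. \<exists>Z'\<in>\<Z>. thickening E Z \<subseteq> Z'"
    unfolding coarse_ents_quotient mem_Collect_eq by blast
  moreover have "\<Z> \<subseteq> Pow (carrier Y)" "\<forall>Z1\<in>\<Z>. \<forall>Z2\<in>\<Z>. \<exists>Z3\<in>\<Z>. Z1 \<union> Z2 \<subseteq> Z3"
    using sub directed by auto
  ultimately have big: "big_family ?B \<Z>"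
    unfolding big_family_def quotient_simps using nonempty by (intro conjI)

  have map: "f \<in> carrier cover \<rightarrow> carrier ?B"
    using f by auto
  have equivariant: "f (cover_action g a) = f a" if "g \<in> carrier G" "a \<in> carrier cover" for g a
    using that f by (auto simp: diagonal_action_def composition_rule inv_mult_group)
  have "map_prod f f ` U \<subseteq> quotient_near l" if U: "U \<subseteq> cover_near l" for U l
  proof -
    have "(f (g', y'), f (g, y)) \<in> quotient_near l" if "((g', y'), (g, y)) \<in> cover_near l" for g' y' g y
      using that f translate[of g g' y'] by (auto simp: cover_near_iff quotient_near_def)
    then show ?thesis
      using U by auto
  qed
  then have controlled: "controlled cover ?B f"
    unfolding controlled_def coarse_ents_cover coarse_ents_quotient by blast
  have bounded: "bornological_map cover ?B f"
    unfolding bornological_map_def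
  proof
    fix K
    assume "K \<in> bounded_sets cover"
    then obtain S B where S: "S \<subseteq> carrier G" "finite S" and B: "B \<in> bounded_sets Y" and K: "K \<subseteq> S \<times> B"
      by (auto simp: bounded_sets_cover)
    have "f ` K \<subseteq> (\<Union>g\<in>S. \<psi> (inv g) ` B)"
    proof
      fix x
      assume "x \<in> f ` K"
      then obtain g y where x: "g \<in> S" "y \<in> B" "x = f (g, y)"
        using K by auto
      then have "x = \<psi> (inv g) y"
        using S(1) bornology_carrier[OF bornology B] f by blast
      then show "x \<in> (\<Union>g\<in>S. \<psi> (inv g) ` B)"
        using x by blast
    qed
    moreover have "(\<Union>g\<in>S. \<psi> (inv g) ` B) \<in> bounded_sets Y"
      using S by (intro bornology_UN[OF bornology] action_bounded B) auto
    ultimately show "f ` K \<in> bounded_sets ?B"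
      using bornology_subset[OF bornology] by simp
  qed
  have finite: "locally_finite_fibres cover ?B f"
    unfolding locally_finite_fibres_def
  proof (intro ballI)
    fix b K
    assume "b \<in> carrier ?B" "K \<in> bounded_sets cover"
    then obtain S B where S: "S \<subseteq> carrier G" "finite S" and K: "K \<subseteq> S \<times> B"
      by (auto simp: bounded_sets_cover)
    \<comment> \<open>Each sheet contains one point of the fibre, and a bounded set meets finitely
      many sheets.\<close>
    have "{a \<in> carrier cover. f a = b} \<inter> K \<subseteq> (\<lambda>g. (g, \<psi> g b)) ` S"
      using K f by auto
    then show "finite ({a \<in> carrier cover. f a = b} \<inter> K)"
      using S(2) by (meson finite_imageI finite_subset)
  qed
  have "\<forall>E\<in>coarse_ents ?B. \<exists>Z\<in>\<Z>.
      (\<forall>(b', b) \<in> E \<inter> (carrier ?B \<times> (carrier ?B - Z)). \<forall>a\<in>carrier cover. f a = b \<longrightarrow>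
        (\<exists>!a'. a' \<in> carrier cover \<and> f a' = b' \<and> (a', a) \<in> invariant_rel Q)) \<and>
      invariant_rel Q \<inter> {(a', a) \<in> carrier cover \<times> carrier cover.
        (f a', f a) \<in> E \<inter> (carrier ?B \<times> (carrier ?B - Z))} \<in> coarse_ents cover"
  proof
    fix E
    assume "E \<in> coarse_ents ?B"
    then obtain l where E: "E \<subseteq> quotient_near l"
      by (auto simp: coarse_ents_quotient)
    have "\<forall>(b', b) \<in> E \<inter> (carrier ?B \<times> (carrier ?B - Z l)). \<forall>a\<in>carrier cover. f a = b \<longrightarrow>
        (\<exists>!a'. a' \<in> carrier cover \<and> f a' = b' \<and> (a', a) \<in> invariant_rel Q)"
    proof (intro ballI, clarsimp simp del: carrier_cover)
      fix b' a
      assume "(b', f a) \<in> E" "f a \<notin> Z l" "a \<in> carrier cover"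
      then show "\<exists>!a'. a' \<in> carrier cover \<and> f a' = b' \<and> (a', a) \<in> invariant_rel Q"
        using covering[of b' "f a" l a] E by blast
    qed
    moreover have "invariant_rel Q \<inter> {(a', a) \<in> carrier cover \<times> carrier cover.
        (f a', f a) \<in> E \<inter> (carrier ?B \<times> (carrier ?B - Z l))} \<in> coarse_ents cover"
      unfolding coarse_ents_cover quotient_simps using lift[OF E] by blast
    ultimately show "\<exists>Z\<in>\<Z>. (\<forall>(b', b) \<in> E \<inter> (carrier ?B \<times> (carrier ?B - Z)). \<forall>a\<in>carrier cover. f a = b \<longrightarrow>
        (\<exists>!a'. a' \<in> carrier cover \<and> f a' = b' \<and> (a', a) \<in> invariant_rel Q)) \<and>
      invariant_rel Q \<inter> {(a', a) \<in> carrier cover \<times> carrier cover.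
        (f a', f a) \<in> E \<inter> (carrier ?B \<times> (carrier ?B - Z))} \<in> coarse_ents cover"
      using Z(1) by (intro bexI[of _ "Z l"] conjI)
  qed
  moreover have "\<forall>U\<in>coarse_ents cover. \<exists>Z\<in>\<Z>.
      U \<inter> (carrier cover \<times> {a \<in> carrier cover. f a \<in> carrier ?B - Z}) \<subseteq> invariant_rel Q"
    unfolding coarse_ents_cover quotient_simps using small Z(1) by blast
  moreover have "invariant_rel Q \<subseteq> carrier cover \<times> carrier cover"
    by (auto simp: invariant_rel_def)
  ultimately have "\<exists>P. P \<subseteq> carrier cover \<times> carrier cover \<and> invariant_entourage G cover_action P \<and>
      (\<forall>E\<in>coarse_ents ?B. \<exists>Z\<in>\<Z>.
        (\<forall>(b', b) \<in> E \<inter> (carrier ?B \<times> (carrier ?B - Z)). \<forall>a\<in>carrier cover. f a = b \<longrightarrow>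
          (\<exists>!a'. a' \<in> carrier cover \<and> f a' = b' \<and> (a', a) \<in> P)) \<and>
        P \<inter> {(a', a) \<in> carrier cover \<times> carrier cover.
          (f a', f a) \<in> E \<inter> (carrier ?B \<times> (carrier ?B - Z))} \<in> coarse_ents cover) \<and>
      (\<forall>U\<in>coarse_ents cover. \<exists>Z\<in>\<Z>.
        U \<inter> (carrier cover \<times> {a \<in> carrier cover. f a \<in> carrier ?B - Z}) \<subseteq> P)"
    using invariant_entourage_invariant_rel by (intro exI[of _ "invariant_rel Q"] conjI)
  then show ?thesis
    unfolding branched_coarse_covering_def
    using G_bornological_coarse_space_cover bornological_coarse_space_quotient big map equivariant
      controlled bounded finite by (intro conjI ballI)
qed

end

section \<open>Entourages of the cone\<close>

lemma uniform_structureD: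
  assumes "uniform_structure X \<U>"
  shows uniform_structure_carrier: "U \<in> \<U> \<Longrightarrow> U \<subseteq> X \<times> X"
    and uniform_structure_Id_on: "U \<in> \<U> \<Longrightarrow> Id_on X \<subseteq> U"
    and uniform_structure_superset: "U \<in> \<U> \<Longrightarrow> U \<subseteq> V \<Longrightarrow> V \<subseteq> X \<times> X \<Longrightarrow> V \<in> \<U>"
    and uniform_structure_converse: "U \<in> \<U> \<Longrightarrow> U\<inverse> \<in> \<U>"
    and uniform_structure_half: "U \<in> \<U> \<Longrightarrow> \<exists>V\<in>\<U>. V O V \<subseteq> U"
proof -
  note * = assms[unfolded uniform_structure_def]
  show "U \<in> \<U> \<Longrightarrow> U \<subseteq> X \<times> X"
    using subsetD[OF conjunct1[OF *]] by simp
  show "U \<in> \<U> \<Longrightarrow> Id_on X \<subseteq> U"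
    using * by meson
  show "U \<in> \<U> \<Longrightarrow> U \<subseteq> V \<Longrightarrow> V \<subseteq> X \<times> X \<Longrightarrow> V \<in> \<U>"
    using * by meson
  show "U \<in> \<U> \<Longrightarrow> U\<inverse> \<in> \<U>"
    using * by meson
  show "U \<in> \<U> \<Longrightarrow> \<exists>V\<in>\<U>. V O V \<subseteq> U"
    using * by meson
qed

text \<open>A description of the entourages of the cone without generators. As levels differ by at
  most \<open>k\<close>, asking for smallness when both ends lie beyond \<open>n0\<close> amounts,
  up to a shift of \<open>n0\<close> by \<open>k\<close>, to asking for it when one end does; the
  symmetric form suits converses.\<close>

definition cone_entourage :: "('a, 'm) ubc_space_scheme \<Rightarrow> ((int \<times> 'a) \<times> (int \<times> 'a)) set \<Rightarrow> bool" where
  "cone_entourage X E \<longleftrightarrow>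
     E \<subseteq> (UNIV \<times> carrier X) \<times> (UNIV \<times> carrier X) \<and>
     (\<exists>k::nat. \<exists>U\<in>coarse_ents X. \<forall>m x n y. ((m, x), (n, y)) \<in> E \<longrightarrow> \<bar>m - n\<bar> \<le> int k \<and> (x, y) \<in> U) \<and>
     (\<forall>V\<in>uniform_ents X. \<exists>n0. \<forall>m x n y. ((m, x), (n, y)) \<in> E \<longrightarrow> m \<ge> n0 \<longrightarrow> n \<ge> n0 \<longrightarrow> (x, y) \<in> V)"

lemma cone_entourageI:
  assumes "E \<subseteq> (UNIV \<times> carrier X) \<times> (UNIV \<times> carrier X)" and "U \<in> coarse_ents X"
    and "\<And>m x n y. ((m, x), (n, y)) \<in> E \<Longrightarrow> \<bar>m - n\<bar> \<le> int k \<and> (x, y) \<in> U"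
    and "\<And>V. V \<in> uniform_ents X \<Longrightarrow>
      \<exists>n0. \<forall>m x n y. ((m, x), (n, y)) \<in> E \<longrightarrow> m \<ge> n0 \<longrightarrow> n \<ge> n0 \<longrightarrow> (x, y) \<in> V"
  shows "cone_entourage X E"
  unfolding cone_entourage_def using assms(1,4)
  by (intro conjI exI[of _ k] bexI[OF _ assms(2)] allI impI ballI assms(3)) simp_all

lemma cone_entourageE:
  assumes "cone_entourage X E"
  obtains k U where "E \<subseteq> (UNIV \<times> carrier X) \<times> (UNIV \<times> carrier X)" "U \<in> coarse_ents X"
    "\<And>m x n y. ((m, x), (n, y)) \<in> E \<Longrightarrow> \<bar>m - n\<bar> \<le> int k \<and> (x, y) \<in> U"
    "\<And>V. V \<in> uniform_ents X \<Longrightarrow>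
      \<exists>n0. \<forall>m x n y. ((m, x), (n, y)) \<in> E \<longrightarrow> m \<ge> n0 \<longrightarrow> n \<ge> n0 \<longrightarrow> (x, y) \<in> V"
proof -
  obtain k U where "U \<in> coarse_ents X"
    "\<forall>m x n y. ((m, x), (n, y)) \<in> E \<longrightarrow> \<bar>m - n\<bar> \<le> int k \<and> (x, y) \<in> U"
    using assms unfolding cone_entourage_def by meson
  then show thesis
    using assms by (intro that[of U k]) (simp_all add: cone_entourage_def)
qed

text \<open>With the identity this is monotonicity of powers; with the inclusion of a level it
  places a chain of points of \<open>X\<close> in the cone.\<close>

lemma relpow_image:
  assumes "\<And>x y. (x, y) \<in> R \<Longrightarrow> (f x, f y) \<in> S" and "(x, y) \<in> R ^^ l"
  shows "(f x, f y) \<in> S ^^ l"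
  using assms(2)
proof (induction l arbitrary: y)
  case (Suc l)
  then obtain z where "(x, z) \<in> R ^^ l" "(z, y) \<in> R"
    by auto
  then show ?case
    using Suc.IH assms(1) by (meson relpow_Suc_I)
qed simp

lemma relpow_refl: "(x, x) \<in> R \<Longrightarrow> (x, x) \<in> R ^^ l"
  by (induction l) auto

context
  fixes X :: "('a, 'm) ubc_space_scheme"
  assumes X: "uniform_bornological_coarse_space X"
begin

lemma coarse_structure_ubc: "coarse_structure (carrier X) (coarse_ents X)"
  and uniform_structure_ubc: "uniform_structure (carrier X) (uniform_ents X)"
  and bornology_ubc: "bornology (carrier X) (bounded_sets X)"
  using X by (simp_all add: uniform_bornological_coarse_space_def bornological_coarse_space_def)

lemma coarse_structure_cone_entourage:
  "coarse_structure (UNIV \<times> carrier X) {E. cone_entourage X E}"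
proof -
  have Id: "cone_entourage X (Id_on (UNIV \<times> carrier X))"
    using uniform_structure_Id_on[OF uniform_structure_ubc]
    by (intro cone_entourageI[OF _ coarse_structure_Id_on[OF coarse_structure_ubc], where k = 0]) auto
  have subset: "cone_entourage X E'" if E: "cone_entourage X E" and E': "E' \<subseteq> E" for E E'
    using E
  proof (rule cone_entourageE)
    fix k U
    assume *: "E \<subseteq> (UNIV \<times> carrier X) \<times> (UNIV \<times> carrier X)" "U \<in> coarse_ents X"
      "\<And>m x n y. ((m, x), (n, y)) \<in> E \<Longrightarrow> \<bar>m - n\<bar> \<le> int k \<and> (x, y) \<in> U"
      "\<And>V. V \<in> uniform_ents X \<Longrightarrow>
        \<exists>n0. \<forall>m x n y. ((m, x), (n, y)) \<in> E \<longrightarrow> m \<ge> n0 \<longrightarrow> n \<ge> n0 \<longrightarrow> (x, y) \<in> V"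
    show ?thesis
    proof (rule cone_entourageI[OF order_trans[OF E' *(1)] *(2)])
      show "\<bar>m - n\<bar> \<le> int k \<and> (x, y) \<in> U" if "((m, x), (n, y)) \<in> E'" for m x n y
        using *(3) subsetD[OF E' that] by blast
      show "\<exists>n0. \<forall>m x n y. ((m, x), (n, y)) \<in> E' \<longrightarrow> m \<ge> n0 \<longrightarrow> n \<ge> n0 \<longrightarrow> (x, y) \<in> V"
        if "V \<in> uniform_ents X" for V
        using *(4)[OF that] subsetD[OF E'] by meson
    qed
  qed
  have converse: "cone_entourage X (E\<inverse>)" if E: "cone_entourage X E" for E
    using E
  proof (rule cone_entourageE)
    fix k U
    assume *: "E \<subseteq> (UNIV \<times> carrier X) \<times> (UNIV \<times> carrier X)" "U \<in> coarse_ents X"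
      "\<And>m x n y. ((m, x), (n, y)) \<in> E \<Longrightarrow> \<bar>m - n\<bar> \<le> int k \<and> (x, y) \<in> U"
      "\<And>V. V \<in> uniform_ents X \<Longrightarrow>
        \<exists>n0. \<forall>m x n y. ((m, x), (n, y)) \<in> E \<longrightarrow> m \<ge> n0 \<longrightarrow> n \<ge> n0 \<longrightarrow> (x, y) \<in> V"
    show ?thesis
    proof (rule cone_entourageI[OF _ coarse_structure_converse[OF coarse_structure_ubc *(2)]])
      show "E\<inverse> \<subseteq> (UNIV \<times> carrier X) \<times> UNIV \<times> carrier X"
        using *(1) by auto
      show "\<bar>m - n\<bar> \<le> int k \<and> (x, y) \<in> U\<inverse>" if "((m, x), (n, y)) \<in> E\<inverse>" for m x n y
        using *(3)[of n y m x] that by auto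
      show "\<exists>n0. \<forall>m x n y. ((m, x), (n, y)) \<in> E\<inverse> \<longrightarrow> m \<ge> n0 \<longrightarrow> n \<ge> n0 \<longrightarrow> (x, y) \<in> V"
        if "V \<in> uniform_ents X" for V
        using *(4)[OF uniform_structure_converse[OF uniform_structure_ubc that]] by (metis converse_iff)
    qed
  qed
  have union: "cone_entourage X (E \<union> E')" if E: "cone_entourage X E" "cone_entourage X E'" for E E'
  proof (rule cone_entourageE[OF E(1)], rule cone_entourageE[OF E(2)])
    fix k U k' U'
    assume *: "E \<subseteq> (UNIV \<times> carrier X) \<times> (UNIV \<times> carrier X)" "U \<in> coarse_ents X"
      "\<And>m x n y. ((m, x), (n, y)) \<in> E \<Longrightarrow> \<bar>m - n\<bar> \<le> int k \<and> (x, y) \<in> U"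
      "\<And>V. V \<in> uniform_ents X \<Longrightarrow>
        \<exists>n0. \<forall>m x n y. ((m, x), (n, y)) \<in> E \<longrightarrow> m \<ge> n0 \<longrightarrow> n \<ge> n0 \<longrightarrow> (x, y) \<in> V"
    assume **: "E' \<subseteq> (UNIV \<times> carrier X) \<times> (UNIV \<times> carrier X)" "U' \<in> coarse_ents X"
      "\<And>m x n y. ((m, x), (n, y)) \<in> E' \<Longrightarrow> \<bar>m - n\<bar> \<le> int k' \<and> (x, y) \<in> U'"
      "\<And>V. V \<in> uniform_ents X \<Longrightarrow>
        \<exists>n0. \<forall>m x n y. ((m, x), (n, y)) \<in> E' \<longrightarrow> m \<ge> n0 \<longrightarrow> n \<ge> n0 \<longrightarrow> (x, y) \<in> V"
    show ?thesis
    proof (rule cone_entourageI[OF Un_least[OF *(1) **(1)] coarse_structure_Un[OF coarse_structure_ubc *(2) **(2)]])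
      show "\<bar>m - n\<bar> \<le> int (max k k') \<and> (x, y) \<in> U \<union> U'" if "((m, x), (n, y)) \<in> E \<union> E'" for m x n y
        using *(3)[of m x n y] **(3)[of m x n y] that by auto
    next
      fix V
      assume V: "V \<in> uniform_ents X"
      obtain n0 where n0: "\<forall>m x n y. ((m, x), (n, y)) \<in> E \<longrightarrow> m \<ge> n0 \<longrightarrow> n \<ge> n0 \<longrightarrow> (x, y) \<in> V"
        using *(4)[OF V] by blast
      obtain n1 where n1: "\<forall>m x n y. ((m, x), (n, y)) \<in> E' \<longrightarrow> m \<ge> n1 \<longrightarrow> n \<ge> n1 \<longrightarrow> (x, y) \<in> V"
        using **(4)[OF V] by blast
      have "\<forall>m x n y. ((m, x), (n, y)) \<in> E \<union> E' \<longrightarrow> m \<ge> max n0 n1 \<longrightarrow> n \<ge> max n0 n1 \<longrightarrow> (x, y) \<in> V"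
        using n0 n1 by auto
      then show "\<exists>n0. \<forall>m x n y. ((m, x), (n, y)) \<in> E \<union> E' \<longrightarrow> m \<ge> n0 \<longrightarrow> n \<ge> n0 \<longrightarrow> (x, y) \<in> V" ..
    qed
  qed
  have comp: "cone_entourage X (E O E')" if E: "cone_entourage X E" "cone_entourage X E'" for E E'
  proof (rule cone_entourageE[OF E(1)], rule cone_entourageE[OF E(2)])
    fix k U k' U'
    assume *: "E \<subseteq> (UNIV \<times> carrier X) \<times> (UNIV \<times> carrier X)" "U \<in> coarse_ents X"
      "\<And>m x n y. ((m, x), (n, y)) \<in> E \<Longrightarrow> \<bar>m - n\<bar> \<le> int k \<and> (x, y) \<in> U"
      "\<And>V. V \<in> uniform_ents X \<Longrightarrow>
        \<exists>n0. \<forall>m x n y. ((m, x), (n, y)) \<in> E \<longrightarrow> m \<ge> n0 \<longrightarrow> n \<ge> n0 \<longrightarrow> (x, y) \<in> V"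
    assume **: "E' \<subseteq> (UNIV \<times> carrier X) \<times> (UNIV \<times> carrier X)" "U' \<in> coarse_ents X"
      "\<And>m x n y. ((m, x), (n, y)) \<in> E' \<Longrightarrow> \<bar>m - n\<bar> \<le> int k' \<and> (x, y) \<in> U'"
      "\<And>V. V \<in> uniform_ents X \<Longrightarrow>
        \<exists>n0. \<forall>m x n y. ((m, x), (n, y)) \<in> E' \<longrightarrow> m \<ge> n0 \<longrightarrow> n \<ge> n0 \<longrightarrow> (x, y) \<in> V"
    show ?thesis
    proof (rule cone_entourageI[OF _ coarse_structure_relcomp[OF coarse_structure_ubc *(2) **(2)]])
      show "E O E' \<subseteq> (UNIV \<times> carrier X) \<times> UNIV \<times> carrier X"
        using *(1) **(1) by auto
      show "\<bar>m - n\<bar> \<le> int (k + k') \<and> (x, y) \<in> U O U'" if EE: "((m, x), (n, y)) \<in> E O E'" for m x n y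
      proof -
        obtain p z where "((m, x), (p, z)) \<in> E" "((p, z), (n, y)) \<in> E'"
          using EE by auto
        then show ?thesis
          using *(3)[of m x p z] **(3)[of p z n y] by auto
      qed
    next
      fix V
      assume V: "V \<in> uniform_ents X"
      obtain V' where V': "V' \<in> uniform_ents X" "V' O V' \<subseteq> V"
        using uniform_structure_half[OF uniform_structure_ubc V] by blast
      obtain n0 where n0: "\<forall>m x n y. ((m, x), (n, y)) \<in> E \<longrightarrow> m \<ge> n0 \<longrightarrow> n \<ge> n0 \<longrightarrow> (x, y) \<in> V'"
        using *(4)[OF V'(1)] by blast
      obtain n1 where n1: "\<forall>m x n y. ((m, x), (n, y)) \<in> E' \<longrightarrow> m \<ge> n1 \<longrightarrow> n \<ge> n1 \<longrightarrow> (x, y) \<in> V'"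
        using **(4)[OF V'(1)] by blast
      \<comment> \<open>The intermediate point may lie \<open>k\<close> levels below the first one;
        raising the threshold by \<open>k\<close> keeps it beyond \<open>n0\<close> and
        \<open>n1\<close>.\<close>
      have "(x, y) \<in> V"
        if EE: "((m, x), (n, y)) \<in> E O E'" and mn: "m \<ge> max n0 n1 + int k" "n \<ge> max n0 n1 + int k" for m x n y
      proof -
        obtain p z where pz: "((m, x), (p, z)) \<in> E" "((p, z), (n, y)) \<in> E'"
          using EE by auto
        then have "p \<ge> max n0 n1"
          using *(3)[of m x p z] mn by linarith
        then have "(x, z) \<in> V'" "(z, y) \<in> V'"
          using n0 n1 pz mn by auto
        then show ?thesis
          using V'(2) by blast
      qed
      then show "\<exists>n0. \<forall>m x n y. ((m, x), (n, y)) \<in> E O E' \<longrightarrow> m \<ge> n0 \<longrightarrow> n \<ge> n0 \<longrightarrow> (x, y) \<in> V"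
        by (intro exI[of _ "max n0 n1 + int k"]) blast
    qed
  qed
  have "{E. cone_entourage X E} \<subseteq> Pow ((UNIV \<times> carrier X) \<times> (UNIV \<times> carrier X))"
    unfolding cone_entourage_def by blast
  then show ?thesis
    unfolding coarse_structure_def mem_Collect_eq
    using Id subset converse union comp by (intro conjI) (assumption | meson)+
qed

text \<open>For minimality, an entourage is factored into a change of level at a fixed point of
  \<open>X\<close>, done by at most \<open>k\<close> shifts, followed by an entourage of
  \<open>Sq X\<close> inside one level.\<close>

lemma coarse_ents_cone: "coarse_ents (cone X) = {E. cone_entourage X E}"
proof -
  let ?shift = "{((n + 1, x), (n, x)) | n x. x \<in> carrier X} :: ((int \<times> 'a) \<times> (int \<times> 'a)) set"
  have "coarse_structure (UNIV \<times> carrier X) hull (coarse_ents (Sq X) \<union> {?shift}) = {E. cone_entourage X E}"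
  proof (rule hull_unique)
    have "cone_entourage X E" if E: "E \<in> coarse_ents (Sq X)" for E
    proof -
      obtain U W where U: "U \<in> coarse_ents X" and W: "asymptotically_uniform X W"
        and EUW: "E \<subseteq> {((n, x), (n, y)) | n x y. (x, y) \<in> U} \<inter> W"
        using E by (auto simp: Sq_def)
      show ?thesis
      proof (rule cone_entourageI[OF _ U, where k = 0])
        show "E \<subseteq> (UNIV \<times> carrier X) \<times> UNIV \<times> carrier X"
          using EUW W unfolding asymptotically_uniform_def by blast
        show "\<bar>m - n\<bar> \<le> int 0 \<and> (x, y) \<in> U" if "((m, x), (n, y)) \<in> E" for m x n y
          using subsetD[OF EUW that] by auto
      next
        fix V
        assume "V \<in> uniform_ents X"
        then obtain n0 where "\<forall>n\<ge>n0. {(x, y). ((n, x), (n, y)) \<in> W} \<subseteq> V"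
          using W unfolding asymptotically_uniform_def by blast
        then have "(x, y) \<in> V" if "((m, x), (n, y)) \<in> E" "m \<ge> n0" for m x n y
          using subsetD[OF EUW that(1)] that(2) by auto
        then show "\<exists>n0. \<forall>m x n y. ((m, x), (n, y)) \<in> E \<longrightarrow> m \<ge> n0 \<longrightarrow> n \<ge> n0 \<longrightarrow> (x, y) \<in> V"
          by blast
      qed
    qed
    moreover have "cone_entourage X ?shift"
      using uniform_structure_Id_on[OF uniform_structure_ubc]
      by (intro cone_entourageI[OF _ coarse_structure_Id_on[OF coarse_structure_ubc], where k = 1]) auto
    ultimately show "coarse_ents (Sq X) \<union> {?shift} \<subseteq> {E. cone_entourage X E}"
      by auto
  next
    show "coarse_structure (UNIV \<times> carrier X) {E. cone_entourage X E}"
      by (rule coarse_structure_cone_entourage)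
  next
    fix \<D>
    assume S: "coarse_ents (Sq X) \<union> {?shift} \<subseteq> \<D>" and \<D>: "coarse_structure (UNIV \<times> carrier X) \<D>"
    \<comment> \<open>The diagonal allows a walk of at most \<open>k\<close> shifts to be padded to
      exactly \<open>k\<close> steps.\<close>
    define S where "S = ?shift \<union> ?shift\<inverse> \<union> Id_on (UNIV \<times> carrier X)"
    have "?shift \<in> \<D>"
      using S by simp
    then have SD: "S \<in> \<D>"
      unfolding S_def by (intro coarse_structure_Un[OF \<D>] coarse_structure_converse[OF \<D>]
        coarse_structure_Id_on[OF \<D>])
    have steps: "((m, x), (n, x)) \<in> S ^^ k" if "x \<in> carrier X" "\<bar>m - n\<bar> \<le> int k" for m n x k
      using that(2)
    proof (induction k arbitrary: m)
      case (Suc k)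
      define m' where "m' = (if m < n then m + 1 else if n < m then m - 1 else m)"
      have "m = m' + 1 \<or> m' = m + 1 \<or> m = m'"
        by (auto simp: m'_def)
      then have "((m, x), (m', x)) \<in> S"
        using that(1) by (auto simp: S_def)
      moreover have "((m', x), (n, x)) \<in> S ^^ k"
        using Suc.prems by (intro Suc.IH) (auto simp: m'_def)
      ultimately show ?case
        by (rule relpow_Suc_I2)
    qed simp
    show "{E. cone_entourage X E} \<subseteq> \<D>"
    proof
      fix E
      assume "E \<in> {E. cone_entourage X E}"
      then have "cone_entourage X E"
        by simp
      then show "E \<in> \<D>"
      proof (rule cone_entourageE)
        fix k U
        assume *: "E \<subseteq> (UNIV \<times> carrier X) \<times> (UNIV \<times> carrier X)" "U \<in> coarse_ents X"
          "\<And>m x n y. ((m, x), (n, y)) \<in> E \<Longrightarrow> \<bar>m - n\<bar> \<le> int k \<and> (x, y) \<in> U"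
          "\<And>V. V \<in> uniform_ents X \<Longrightarrow>
            \<exists>n0. \<forall>m x n y. ((m, x), (n, y)) \<in> E \<longrightarrow> m \<ge> n0 \<longrightarrow> n \<ge> n0 \<longrightarrow> (x, y) \<in> V"
        \<comment> \<open>Both ends are put on the level of the second. The first may come from a
          level lower by \<open>k\<close>, so the threshold for asymptotic uniformity grows by
          \<open>k\<close>.\<close>
        define E0 where "E0 = {((n, x), (n, y)) | m n x y. ((m, x), (n, y)) \<in> E}"
        have "asymptotically_uniform X E0"
          unfolding asymptotically_uniform_def
        proof (intro conjI ballI)
          show "E0 \<subseteq> (UNIV \<times> carrier X) \<times> UNIV \<times> carrier X"
            using *(1) by (auto simp: E0_def)
        next
          fix V
          assume "V \<in> uniform_ents X"
          then obtain n0 where n0: "\<forall>m x n y. ((m, x), (n, y)) \<in> E \<longrightarrow> m \<ge> n0 \<longrightarrow> n \<ge> n0 \<longrightarrow> (x, y) \<in> V"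
            using *(4) by blast
          have "(x, y) \<in> V" if n: "n \<ge> n0 + int k" and E0: "((n, x), (n, y)) \<in> E0" for n x y
          proof -
            obtain m where m: "((m, x), (n, y)) \<in> E"
              using E0 by (auto simp: E0_def)
            then have "m \<ge> n0"
              using *(3)[OF m] n by linarith
            then show ?thesis
              using n0 m n by auto
          qed
          then show "\<exists>n0. \<forall>n\<ge>n0. {(x, y). ((n, x), (n, y)) \<in> E0} \<subseteq> V"
            by (intro exI[of _ "n0 + int k"]) auto
        qed
        moreover have "E0 \<subseteq> {((n, x), (n, y)) | n x y. (x, y) \<in> U} \<inter> E0"
          using *(3) by (auto simp: E0_def)
        ultimately have "E0 \<in> coarse_ents (Sq X)"
          using *(2) by (auto simp: Sq_def)
        then have "E0 \<in> \<D>"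
          using S by blast
        have "E \<subseteq> ((S ^^ k) \<inter> (UNIV \<times> carrier X) \<times> (UNIV \<times> carrier X)) O E0"
        proof (rule subrelI)
          fix p q
          assume pq: "(p, q) \<in> E"
          obtain m x n y where p: "p = (m, x)" "q = (n, y)"
            by (metis surj_pair)
          have "x \<in> carrier X" "\<bar>m - n\<bar> \<le> int k"
            using pq *(1) *(3)[of m x n y] by (auto simp: p)
          then have "((m, x), (n, x)) \<in> (S ^^ k) \<inter> (UNIV \<times> carrier X) \<times> (UNIV \<times> carrier X)"
            using steps by auto
          moreover have "((n, x), (n, y)) \<in> E0"
            using pq by (auto simp: E0_def p)
          ultimately show "(p, q) \<in> ((S ^^ k) \<inter> (UNIV \<times> carrier X) \<times> (UNIV \<times> carrier X)) O E0"
            unfolding p by (rule relcompI)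
        qed
        then show "E \<in> \<D>"
          using coarse_structure_relcomp[OF \<D> coarse_structure_relpow[OF \<D> SD] \<open>E0 \<in> \<D>\<close>]
            coarse_structure_subset[OF \<D>] by meson
      qed
    qed
  qed
  then show ?thesis
    by (simp add: cone_def)
qed

section \<open>The bornology of the cone and its compatibility with the entourages\<close>

lemma carrier_cone [simp]: "carrier (cone X) = UNIV \<times> carrier X"
  by (simp add: cone_def Sq_def)

lemma bounded_sets_cone: "bounded_sets (cone X) =
    {A. \<exists>F B. finite F \<and> B \<in> bounded_sets X \<and> A \<subseteq> F \<times> B}"
  using product_bornology_hull[OF bornology_ubc, of UNIV] by (simp add: cone_def Sq_def)

lemma bornological_coarse_space_cone: "bornological_coarse_space (cone X)"
proof -
  have "thickening E A \<in> bounded_sets (cone X)"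
    if E: "E \<in> coarse_ents (cone X)" and A: "A \<in> bounded_sets (cone X)" for E A
  proof -
    have "cone_entourage X E"
      using E by (simp add: coarse_ents_cone)
    then obtain k U where U: "U \<in> coarse_ents X"
      and k: "\<And>m x n y. ((m, x), (n, y)) \<in> E \<Longrightarrow> \<bar>m - n\<bar> \<le> int k \<and> (x, y) \<in> U"
      unfolding cone_entourage_def by meson
    obtain S B where S: "finite S" and B: "B \<in> bounded_sets X" and AS: "A \<subseteq> S \<times> B"
      using A by (auto simp: bounded_sets_cone)
    have "thickening E A \<subseteq> (\<Union>n\<in>S. {n - int k..n + int k}) \<times> thickening U B"
      using AS k by (force simp: thickening_def abs_le_iff)
    moreover have "thickening U B \<in> bounded_sets X"
      using X U B by (simp add: uniform_bornological_coarse_space_def bornological_coarse_space_def)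
    moreover have "finite (\<Union>n\<in>S. {n - int k..n + int k})"
      using S by simp
    ultimately show ?thesis
      unfolding bounded_sets_cone mem_Collect_eq by blast
  qed
  moreover have "bornology (carrier (cone X)) (bounded_sets (cone X))"
    using product_bornology[OF bornology_ubc, of UNIV] by (simp add: bounded_sets_cone)
  moreover have "coarse_structure (carrier (cone X)) (coarse_ents (cone X))"
    unfolding coarse_ents_cone carrier_cone by (rule coarse_structure_cone_entourage)
  ultimately show ?thesis
    by (simp add: bornological_coarse_space_def)
qed

end

section \<open>Lipschitz entourages of the cone\<close>

lemma cone_big_family_iff: "Z \<in> cone_big_family X \<longleftrightarrow> (\<exists>n::nat. Z = {..int n} \<times> carrier X)"
  by (auto simp: cone_big_family_def)

lemma group_action_cone:
  assumes "group_action G (carrier X) \<phi>"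
  shows "group_action G (UNIV \<times> carrier X) (cone_action X \<phi>)"
proof -
  interpret group_action G "carrier X" \<phi>
    by fact
  have "cone_action X \<phi> = (\<lambda>g. restrict (\<lambda>(n, x). (n, \<phi> g x)) (UNIV \<times> carrier X))"
    by (auto simp: cone_action_def)
  moreover have "group_action G (UNIV \<times> carrier X) (\<lambda>g. restrict (\<lambda>(n, x). (n, \<phi> g x)) (UNIV \<times> carrier X))"
  proof (rule group_action_restrictI)
    show "group G"
      using group_hom group_hom.axioms(1) by blast
    show "(case p of (n, x) \<Rightarrow> (n, \<phi> g x)) \<in> UNIV \<times> carrier X" if "g \<in> carrier G" "p \<in> UNIV \<times> carrier X" for g p
      using that element_image by auto
    show "(case p of (n, x) \<Rightarrow> (n, \<phi> \<one>\<^bsub>G\<^esub> x)) = p" if "p \<in> UNIV \<times> carrier X" for p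
      using that by (auto simp flip: id_eq_one)
  qed (use composition_rule in auto)
  ultimately show ?thesis
    by simp
qed

text \<open>Collecting all elements of index at most \<open>l\<close> makes the sets increase and
  treats finite and infinite \<open>A\<close> alike.\<close>

lemma countable_exhaustion:
  assumes "countable A"
  obtains F :: "nat \<Rightarrow> 'a set"
  where "\<And>l. finite (F l)" "\<And>l m. l \<le> m \<Longrightarrow> F l \<subseteq> F m" "(\<Union>l. F l) = A"
proof
  let ?F = "\<lambda>l. {a \<in> A. to_nat_on A a \<le> l}"
  show "finite (?F l)" for l
  proof (rule inj_on_finite)
    show "inj_on (to_nat_on A) (?F l)"
      using inj_on_to_nat_on[OF assms] by (rule inj_on_subset) blast
    show "to_nat_on A ` ?F l \<subseteq> {..l}"
      by auto
  qed simp
  show "?F l \<subseteq> ?F m" if "l \<le> m" for l m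
    using that by auto
  show "(\<Union>l. ?F l) = A"
    by auto
qed

text \<open>The cofinal set of the theorem. The conditions on \<open>V\<close> are those of the
  locale \<open>lipschitz_entourage\<close>, and the exponent \<open>k\<close> may depend on
  \<open>g\<close>.\<close>

definition Lipschitz_entourages ::
  "('g, 'k) monoid_scheme \<Rightarrow> ('a, 'm) ubc_space_scheme \<Rightarrow> ('g \<Rightarrow> 'a \<Rightarrow> 'a) \<Rightarrow>
    ((int \<times> 'a) \<times> (int \<times> 'a)) set set" where
  "Lipschitz_entourages G X \<phi> = {V \<in> coarse_ents (cone X). Id_on (carrier (cone X)) \<subseteq> V \<and> V\<inverse> = V \<and>
     (\<forall>g\<in>carrier G. \<exists>k. map_prod (cone_action X \<phi> g) (cone_action X \<phi> g) ` V \<subseteq> V ^^ k)}"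

text \<open>Powers of \<open>V\<close> are entourages of the cone, hence far out contained in any
  given uniform entourage, in particular in one that avoids the displacement by \<open>g\<close>. In
  this way uniform freeness provides the premise \<open>free\<close> for the family of lower half
  cones.\<close>

lemma branched_coarse_covering_cone:
  assumes G: "group G" and X: "uniform_bornological_coarse_space X"
    and action: "acts_by_ubc_automorphisms G X \<phi>"
    and countable: "countable (carrier G)"
    and free: "uniformly_free G X \<phi>"
    and V: "V \<in> Lipschitz_entourages G X \<phi>"
  shows "acts_by_bc_automorphisms G (with_generator (cone X) V) (cone_action X \<phi>)"
    and "branched_coarse_covering G
      (semidirect_quotient G (with_generator (cone X) V) (cone_action X \<phi>))
      (diagonal_action G (with_generator (cone X) V) (cone_action X \<phi>))
      (coarse_quotient G (with_generator (cone X) V) (cone_action X \<phi>))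
      (cone_big_family X) (\<lambda>(g, n, x). (n, \<phi> (inv\<^bsub>G\<^esub> g) x))"
proof -
  interpret group_action G "carrier X" \<phi>
    using action by (simp add: acts_by_ubc_automorphisms_def)
  interpret group G
    by (rule G)
  have closed: "\<phi> g x \<in> carrier X" if "g \<in> carrier G" "x \<in> carrier X" for g x
    using element_image that by blast
  obtain F :: "nat \<Rightarrow> 'a set" where F: "\<And>l. finite (F l)" "\<And>l m. l \<le> m \<Longrightarrow> F l \<subseteq> F m" "(\<Union>l. F l) = carrier G"
    using countable_exhaustion[OF countable] by blast
  \<comment> \<open>The image under \<open>\<phi> g\<close> is the preimage under the inverse, so
    properness of the latter applies.\<close>
  have bounded: "\<phi> g ` B \<in> bounded_sets X" if g: "g \<in> carrier G" and B: "B \<in> bounded_sets X" for g B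
  proof -
    have "proper_map X X (\<phi> (inv\<^bsub>G\<^esub> g))"
      using action g by (simp add: acts_by_ubc_automorphisms_def ubc_automorphism_def bc_automorphism_def)
    then have *: "{x \<in> carrier X. \<phi> (inv\<^bsub>G\<^esub> g) x \<in> B} \<in> bounded_sets X"
      using B by (simp add: proper_map_def)
    have "\<phi> (inv\<^bsub>G\<^esub> g) (\<phi> g x) = x" if "x \<in> carrier X" for x
      using orbit_sym_aux[OF g that] by simp
    then have "\<phi> g ` B \<subseteq> {x \<in> carrier X. \<phi> (inv\<^bsub>G\<^esub> g) x \<in> B}"
      using bornology_carrier[OF bornology_ubc[OF X] B] closed[OF g] by auto
    then show ?thesis
      using bornology_subset[OF bornology_ubc[OF X] *] by blast
  qed
  have act [simp]: "cone_action X \<phi> g (n, x) = (n, \<phi> g x)" if "x \<in> carrier X" for g n x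
    using that by (simp add: cone_action_def)
  interpret cone: lipschitz_entourage G "cone X" "cone_action X \<phi>" V F
  proof (intro lipschitz_entourage.intro lipschitz_entourage_axioms.intro)
    show "group_action G (carrier (cone X)) (cone_action X \<phi>)"
      using group_action_cone[OF group_action_axioms] by (simp add: carrier_cone[OF X])
    show "bornological_coarse_space (cone X)"
      by (rule bornological_coarse_space_cone[OF X])
  next
    fix g A
    assume g: "g \<in> carrier G" and "A \<in> bounded_sets (cone X)"
    then obtain S B where S: "finite S" and B: "B \<in> bounded_sets X" and A: "A \<subseteq> S \<times> B"
      by (auto simp: bounded_sets_cone[OF X])
    have "cone_action X \<phi> g ` A \<subseteq> S \<times> \<phi> g ` B"
      using A bornology_carrier[OF bornology_ubc[OF X] B] by force
    then show "cone_action X \<phi> g ` A \<in> bounded_sets (cone X)"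
      using S bounded[OF g B] unfolding bounded_sets_cone[OF X] mem_Collect_eq by blast
  qed (use V F in \<open>simp_all add: Lipschitz_entourages_def\<close>)
  show "acts_by_bc_automorphisms G (with_generator (cone X) V) (cone_action X \<phi>)"
    by (rule cone.acts_by_bc_automorphisms_with_generator)
  show "branched_coarse_covering G
      (semidirect_quotient G (with_generator (cone X) V) (cone_action X \<phi>))
      (diagonal_action G (with_generator (cone X) V) (cone_action X \<phi>))
      (coarse_quotient G (with_generator (cone X) V) (cone_action X \<phi>))
      (cone_big_family X) (\<lambda>(g, n, x). (n, \<phi> (inv\<^bsub>G\<^esub> g) x))"
  proof (rule cone.branched_coarse_covering_cover)
    show "cone_big_family X \<noteq> {}"
      by (auto simp: cone_big_family_def)
    show "Z \<subseteq> carrier (cone X)" if "Z \<in> cone_big_family X" for Z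
      using that by (auto simp: cone_big_family_iff carrier_cone[OF X])
  next
    fix Z1 Z2
    assume "Z1 \<in> cone_big_family X" "Z2 \<in> cone_big_family X"
    then obtain n1 n2 :: nat where Z: "Z1 = {..int n1} \<times> carrier X" "Z2 = {..int n2} \<times> carrier X"
      by (auto simp: cone_big_family_iff)
    then have "Z1 \<union> Z2 \<subseteq> {..int (max n1 n2)} \<times> carrier X"
      by auto
    then show "\<exists>Z3\<in>cone_big_family X. Z1 \<union> Z2 \<subseteq> Z3"
      unfolding cone_big_family_def by blast
  next
    fix Z
    assume "Z \<in> cone_big_family X"
    then obtain n :: nat where Z: "Z = {..int n} \<times> carrier X"
      by (auto simp: cone_big_family_iff)
    have "cone_entourage X V"
      using cone.V_coarse by (simp add: coarse_ents_cone[OF X])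
    then obtain k where k: "\<And>m x n y. ((m, x), (n, y)) \<in> V \<Longrightarrow> \<bar>m - n\<bar> \<le> int k"
      and carrier: "V \<subseteq> (UNIV \<times> carrier X) \<times> (UNIV \<times> carrier X)"
      unfolding cone_entourage_def by meson
    have "thickening V Z \<subseteq> {..int (n + k)} \<times> carrier X"
    proof
      fix p
      assume "p \<in> thickening V Z"
      then obtain m x i y where p: "p = (m, x)" and i: "i \<le> int n" and mi: "((m, x), (i, y)) \<in> V"
        by (cases p) (auto simp: thickening_def Z)
      then show "p \<in> {..int (n + k)} \<times> carrier X"
        using k[OF mi] carrier by auto
    qed
    then show "\<exists>Z'\<in>cone_big_family X. thickening V Z \<subseteq> Z'"
      unfolding cone_big_family_def by blast
  next
    fix Z g
    assume "Z \<in> cone_big_family X" "g \<in> carrier G"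
    then show "cone_action X \<phi> g ` Z \<subseteq> Z"
      using closed by (auto simp: cone_big_family_iff)
  next
    fix g l
    assume g: "g \<in> carrier G" "g \<noteq> \<one>\<^bsub>G\<^esub>"
    then obtain U where U: "U \<in> uniform_ents X" "U \<inter> {(\<phi> g x, x) | x. x \<in> carrier X} = {}"
      using free unfolding uniformly_free_def by blast
    have "cone_entourage X (cone.near l)"
      using cone.near_coarse by (simp add: coarse_ents_cone[OF X])
    then obtain n0 where n0: "\<And>m x n y. ((m, x), (n, y)) \<in> cone.near l \<Longrightarrow> m \<ge> n0 \<Longrightarrow> n \<ge> n0 \<Longrightarrow> (x, y) \<in> U"
      using U(1) unfolding cone_entourage_def by meson
    \<comment> \<open>The threshold \<open>n0\<close> may be negative, whereas the family is indexed
      by natural numbers; hence \<open>nat n0\<close>.\<close>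
    have "p \<in> {..int (nat n0)} \<times> carrier X"
      if "p \<in> carrier (cone X)" and near: "(cone_action X \<phi> g p, p) \<in> V ^^ l" for p
    proof -
      obtain n x where p: "p = (n, x)" and x: "x \<in> carrier X"
        using \<open>p \<in> carrier (cone X)\<close> by (auto simp: carrier_cone[OF X])
      have "((n, \<phi> g x), (n, x)) \<in> cone.near l"
        using near x closed[OF g(1) x] by (simp add: p cone.near_def carrier_cone[OF X])
      moreover have "(\<phi> g x, x) \<notin> U"
        using U(2) x by blast
      ultimately have "\<not> n \<ge> n0"
        using n0 by blast
      then show ?thesis
        using x by (auto simp: p)
    qed
    then show "\<exists>Z\<in>cone_big_family X. \<forall>p\<in>carrier (cone X). (cone_action X \<phi> g p, p) \<in> V ^^ l \<longrightarrow> p \<in> Z"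
      unfolding cone_big_family_def by blast
  next
    fix g p
    assume "g \<in> carrier G" "p \<in> carrier (cone X)"
    then show "(\<lambda>(g, n, x). (n, \<phi> (inv\<^bsub>G\<^esub> g) x)) (g, p) = cone_action X \<phi> (inv\<^bsub>G\<^esub> g) p"
      by (auto simp: carrier_cone[OF X])
  qed
qed

text \<open>For a pair of the converse, the image of the reversed pair is joined by a chain that can
  be reversed in turn. A final reflexive step makes the exponent positive, because the low levels of
  the cone, which are not taken from the scale, need at least one step.\<close>

lemma Lipschitz_scale_symmetric:
  assumes X: "uniform_bornological_coarse_space X"
    and L: "Lipschitz_scale G X \<phi> L" and g: "g \<in> carrier G"
    and closed: "\<And>x. x \<in> carrier X \<Longrightarrow> \<phi> g x \<in> carrier X"
  shows "\<exists>k. \<forall>n x y. (x, y) \<in> L n \<union> (L n)\<inverse> \<longrightarrow> (\<phi> g x, \<phi> g y) \<in> (L n \<union> (L n)\<inverse>) ^^ Suc k"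
proof -
  note unif = uniform_structure_ubc[OF X]
  have L_unif: "L n \<in> uniform_ents X" for n
    using L by (simp add: Lipschitz_scale_def uniform_scale_def)
  obtain k where k: "\<And>n l. map_prod (\<phi> g) (\<phi> g) ` (L n ^^ l) \<subseteq> L n ^^ (l * k)"
    using L g unfolding Lipschitz_scale_def by blast
  define W where "W n = L n \<union> (L n)\<inverse>" for n
  have W_sym: "(W n)\<inverse> = W n" for n
    by (auto simp: W_def)
  have L_step: "(\<phi> g x, \<phi> g y) \<in> W n ^^ k" if "(x, y) \<in> L n" for n x y
  proof -
    have "(\<phi> g x, \<phi> g y) \<in> L n ^^ k"
      using k[where n = n and l = 1] that by (auto simp: image_subset_iff)
    then show ?thesis
      using relpow_image[of "L n" "\<lambda>x. x" "W n"] by (auto simp: W_def)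
  qed
  have "(\<phi> g x, \<phi> g y) \<in> W n ^^ Suc k" if xy: "(x, y) \<in> W n" for n x y
  proof -
    have "(\<phi> g x, \<phi> g y) \<in> W n ^^ k"
      using xy L_step[of x y n] relpow_sym[OF W_sym L_step[of y x n]] by (auto simp: W_def)
    moreover have "y \<in> carrier X"
      using xy uniform_structure_carrier[OF unif L_unif] by (auto simp: W_def)
    then have "(\<phi> g y, \<phi> g y) \<in> W n"
      using closed uniform_structure_Id_on[OF unif L_unif] by (auto simp: W_def)
    ultimately show ?thesis
      by (rule relpow_Suc_I)
  qed
  then show ?thesis
    unfolding W_def by blast
qed

text \<open>The scale fed into the Lipschitz condition records \<open>E\<close> level by level, so
  that the dominating Lipschitz scale contains \<open>E\<close> far out. Its constant for
  \<open>g\<close> is independent of the stage; therefore a translate of \<open>V\<close> lies in a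
  single power of \<open>V\<close>.\<close>

lemma cofinal_Lipschitz_entourage:
  assumes X: "uniform_bornological_coarse_space X"
    and G_space: "G_bornological_coarse_space G X \<phi>"
    and scale: "\<exists>T. uniform_scale X T"
    and Lipschitz: "Lipschitz_action G X \<phi>"
    and E: "E \<in> coarse_ents (cone X)"
  shows "\<exists>V\<in>Lipschitz_entourages G X \<phi>. E \<subseteq> V"
proof -
  note unif = uniform_structure_ubc[OF X] and coarse = coarse_structure_ubc[OF X]
  interpret group_action G "carrier X" \<phi>
    using G_space by (simp add: G_bornological_coarse_space_def acts_by_bc_automorphisms_def)
  have closed: "\<phi> g x \<in> carrier X" if "g \<in> carrier G" "x \<in> carrier X" for g x
    using element_image that by blast
  have "cone_entourage X E"
    using E by (simp add: coarse_ents_cone[OF X])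
  then obtain k U where E_carrier: "E \<subseteq> (UNIV \<times> carrier X) \<times> (UNIV \<times> carrier X)" and U: "U \<in> coarse_ents X"
    and E_near: "\<And>m x n y. ((m, x), (n, y)) \<in> E \<Longrightarrow> \<bar>m - n\<bar> \<le> int k \<and> (x, y) \<in> U"
    and E_unif: "\<And>V. V \<in> uniform_ents X \<Longrightarrow>
      \<exists>n0. \<forall>m x n y. ((m, x), (n, y)) \<in> E \<longrightarrow> m \<ge> n0 \<longrightarrow> n \<ge> n0 \<longrightarrow> (x, y) \<in> V"
    by (rule cone_entourageE) blast

  obtain T where T: "uniform_scale X T"
    using scale by blast
  \<comment> \<open>\<open>T i\<close> makes the stage uniform, and cofinality combines that of
    \<open>T\<close> with the asymptotic uniformity of \<open>E\<close>. The stages are indexed so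
    that a pair of \<open>E\<close> appears in the one belonging to the smaller of its two
    levels.\<close>
  define S where "S i = T i \<union> {(x, y). \<exists>m n. m \<ge> int i \<and> n \<ge> int i \<and> ((m, x), (n, y)) \<in> E}" for i
  have "uniform_scale X S"
    unfolding uniform_scale_def
  proof (intro conjI allI ballI)
    fix i
    have "T i \<in> uniform_ents X"
      using T by (simp add: uniform_scale_def)
    moreover from this have "S i \<subseteq> carrier X \<times> carrier X"
      using uniform_structure_carrier[OF unif] E_carrier by (fastforce simp: S_def)
    moreover have "T i \<subseteq> S i"
      by (auto simp: S_def)
    ultimately show "S i \<in> uniform_ents X"
      using uniform_structure_superset[OF unif] by meson
  next
    fix V
    assume V: "V \<in> uniform_ents X"
    obtain n0 where n0: "\<forall>m x n y. ((m, x), (n, y)) \<in> E \<longrightarrow> m \<ge> n0 \<longrightarrow> n \<ge> n0 \<longrightarrow> (x, y) \<in> V"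
      using E_unif[OF V] by blast
    have "\<forall>\<^sub>F i in sequentially. T i \<subseteq> V"
      using T V by (simp add: uniform_scale_def)
    then show "\<forall>\<^sub>F i in sequentially. S i \<subseteq> V"
      using eventually_ge_at_top[of "nat n0"]
    proof eventually_elim
      case (elim i)
      have "n0 \<le> int i"
        using elim(2) by linarith
      then have "(x, y) \<in> V" if "m \<ge> int i" "n \<ge> int i" "((m, x), (n, y)) \<in> E" for m n x y
        using n0 that by (meson order_trans)
      then show ?case
        using elim(1) by (auto simp: S_def)
    qed
  qed
  then obtain L where L: "Lipschitz_scale G X \<phi> L" and SL: "\<And>i. S i \<subseteq> L i"
    using Lipschitz unfolding Lipschitz_action_def dominated_def by blast
  have L_unif: "L i \<in> uniform_ents X" for i
    using L by (simp add: Lipschitz_scale_def uniform_scale_def)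
  have L_cofinal: "\<forall>\<^sub>F i in sequentially. L i \<subseteq> V" if "V \<in> uniform_ents X" for V
    using L that by (simp add: Lipschitz_scale_def uniform_scale_def)

  \<comment> \<open>An entourage that is coarse and uniform: all late stages of \<open>L\<close> lie
    in it and are therefore coarse.\<close>
  obtain C where C: "C \<in> coarse_ents X" "C \<in> uniform_ents X"
    using X by (auto simp: uniform_bornological_coarse_space_def)
  \<comment> \<open>Invariance makes this entourage usable at the low levels in place of the scale;
    it contains \<open>U\<close> to cover \<open>E\<close> there and \<open>C\<close> to contain the
    late stages.\<close>
  obtain R0 where R0: "R0 \<in> coarse_ents X" "invariant_entourage G \<phi> R0" "U \<union> C \<subseteq> R0"
    using G_space coarse_structure_Un[OF coarse U C(1)] unfolding G_bornological_coarse_space_def by blast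
  define R where "R = R0 \<union> R0\<inverse>"
  have R: "R \<in> coarse_ents X"
    unfolding R_def by (intro coarse_structure_Un[OF coarse] coarse_structure_converse[OF coarse] R0)
  have R_refl: "Id_on (carrier X) \<subseteq> R"
    using uniform_structure_Id_on[OF unif C(2)] R0(3) by (auto simp: R_def)
  have R_invariant: "(\<phi> g x, \<phi> g y) \<in> R" if g: "g \<in> carrier G" and "(x, y) \<in> R" for g x y
  proof -
    have "(\<phi> g x, \<phi> g y) \<in> R0" if "(x, y) \<in> R0" for x y
      using R0(2) g that unfolding invariant_entourage_def by (metis map_prod_imageI)
    then show ?thesis
      using that(2) by (auto simp: R_def)
  qed
  obtain n1 where n1: "\<And>i. i \<ge> n1 \<Longrightarrow> L i \<subseteq> C"
    using L_cofinal[OF C(2)] by (auto simp: eventually_sequentially)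

  text \<open>From stage \<^term>\<open>n1\<close> on the scale is finer than \<^term>\<open>R\<close>, so no intersection with
    \<^term>\<open>R\<close>, which might spoil the Lipschitz property, is needed there.\<close>
  define D where "D i = (if i < int n1 then R else L (nat i) \<union> (L (nat i))\<inverse>)" for i
  have D_R: "D i \<subseteq> R" for i
  proof (cases "i < int n1")
    case False
    then have "n1 \<le> nat i"
      by linarith
    then have "L (nat i) \<subseteq> R0"
      using n1 R0(3) by blast
    then show ?thesis
      using False by (auto simp: D_def R_def)
  qed (simp add: D_def)
  have D_carrier: "D i \<subseteq> carrier X \<times> carrier X" for i
    using D_R coarse_structure_carrier[OF coarse R] by blast
  have D_refl: "(x, x) \<in> D i" if "x \<in> carrier X" for x i
    using that R_refl uniform_structure_Id_on[OF unif L_unif] by (auto simp: D_def)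
  have D_sym: "(y, x) \<in> D i" if "(x, y) \<in> D i" for x y i
    using that by (auto simp: D_def R_def split: if_splits)
  have D_Lipschitz: "\<exists>k. \<forall>i x y. (x, y) \<in> D i \<longrightarrow> (\<phi> g x, \<phi> g y) \<in> D i ^^ k" if g: "g \<in> carrier G" for g
  proof -
    obtain k where k: "\<And>n x y. (x, y) \<in> L n \<union> (L n)\<inverse> \<Longrightarrow> (\<phi> g x, \<phi> g y) \<in> (L n \<union> (L n)\<inverse>) ^^ Suc k"
      using Lipschitz_scale_symmetric[OF X L g closed[OF g]] by blast
    have "(\<phi> g x, \<phi> g y) \<in> D i ^^ Suc k" if xy: "(x, y) \<in> D i" for i x y
    proof (cases "i < int n1")
      case True
      then have "D i = R"
        by (simp add: D_def)
      moreover have "x \<in> carrier X"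
        using D_carrier xy by blast
      ultimately show ?thesis
        using xy R_invariant[OF g] D_refl[OF closed[OF g], of x i] by (metis relpow_Suc_I relpow_refl)
    next
      case False
      then show ?thesis
        using xy k[of x y "nat i"] by (simp only: D_def if_False)
    qed
    then show ?thesis
      by blast
  qed

  \<comment> \<open>The index \<open>min m n\<close> matches \<open>S\<close>, whose stage
    \<open>i\<close> collects the pairs of \<open>E\<close> with both levels at least
    \<open>i\<close>.\<close>
  define V where "V = {((m, x), (n, y)) | m x n y. \<bar>m - n\<bar> \<le> int k \<and> (x, y) \<in> D (min m n)}"
  have V_iff: "((m, x), (n, y)) \<in> V \<longleftrightarrow> \<bar>m - n\<bar> \<le> int k \<and> (x, y) \<in> D (min m n)" for m x n y
    by (simp add: V_def)
  have "cone_entourage X V"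
  proof (rule cone_entourageI[OF _ R])
    show "V \<subseteq> (UNIV \<times> carrier X) \<times> UNIV \<times> carrier X"
      using D_carrier by (fastforce simp: V_def)
    show "\<bar>m - n\<bar> \<le> int k \<and> (x, y) \<in> R" if "((m, x), (n, y)) \<in> V" for m x n y
      using that D_R by (auto simp: V_iff)
  next
    fix W
    assume W: "W \<in> uniform_ents X"
    obtain n2 where n2: "\<And>i. i \<ge> n2 \<Longrightarrow> L i \<subseteq> W"
      using L_cofinal[OF W] by (auto simp: eventually_sequentially)
    obtain n3 where n3: "\<And>i. i \<ge> n3 \<Longrightarrow> L i \<subseteq> W\<inverse>"
      using L_cofinal[OF uniform_structure_converse[OF unif W]] by (auto simp: eventually_sequentially)
    \<comment> \<open>\<open>n3\<close> accounts for the symmetrization of the stages, and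
      \<open>n1\<close> excludes the levels where \<open>R\<close> is used.\<close>
    define n0 where "n0 = max n1 (max n2 n3)"
    have "(x, y) \<in> W" if "((m, x), (n, y)) \<in> V" and mn: "m \<ge> int n0" "n \<ge> int n0" for m x n y
    proof -
      let ?i = "nat (min m n)"
      have "\<not> min m n < int n1" "?i \<ge> n2" "?i \<ge> n3"
        using mn by (auto simp: n0_def)
      then have "(x, y) \<in> L ?i \<union> (L ?i)\<inverse>" "L ?i \<subseteq> W" "L ?i \<subseteq> W\<inverse>"
        using that(1) n2 n3 by (simp_all only: V_iff D_def if_False)
      then show ?thesis
        by auto
    qed
    then show "\<exists>n0. \<forall>m x n y. ((m, x), (n, y)) \<in> V \<longrightarrow> m \<ge> n0 \<longrightarrow> n \<ge> n0 \<longrightarrow> (x, y) \<in> W"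
      by blast
  qed
  moreover have "Id_on (carrier (cone X)) \<subseteq> V"
    using D_refl by (auto simp: carrier_cone[OF X] V_iff)
  moreover have "V\<inverse> = V"
  proof -
    have "(q, p) \<in> V" if "(p, q) \<in> V" for p q
      using that D_sym by (auto simp: V_def abs_minus_commute min.commute)
    then show ?thesis
      by auto
  qed
  moreover have "\<exists>K. map_prod (cone_action X \<phi> g) (cone_action X \<phi> g) ` V \<subseteq> V ^^ K" if g: "g \<in> carrier G" for g
  proof -
    obtain K where K: "\<And>i x y. (x, y) \<in> D i \<Longrightarrow> (\<phi> g x, \<phi> g y) \<in> D i ^^ K"
      using D_Lipschitz[OF g] by blast
    have level: "((i, \<phi> g x), (i, \<phi> g y)) \<in> V ^^ K" if "(x, y) \<in> D i" for i x y
      using relpow_image[of "D i" "\<lambda>x. (i, x)" V] K[OF that] by (simp add: V_iff)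
    \<comment> \<open>\<open>K\<close> steps inside the lower level move the point of
      \<open>X\<close>, and one further step changes the level at a fixed point, where
      \<open>D\<close> is reflexive. Which comes first depends on which end is lower.\<close>
    have "(cone_action X \<phi> g (m, x), cone_action X \<phi> g (n, y)) \<in> V ^^ Suc K" if mn: "((m, x), (n, y)) \<in> V" for m x n y
    proof -
      have D: "(x, y) \<in> D (min m n)" and k: "\<bar>m - n\<bar> \<le> int k"
        using mn by (simp_all add: V_iff)
      then have carrier: "x \<in> carrier X" "y \<in> carrier X"
        using D_carrier by auto
      have "((m, \<phi> g x), (n, \<phi> g y)) \<in> V ^^ Suc K"
      proof (cases "m \<le> n")
        case True
        have "((m, \<phi> g y), (n, \<phi> g y)) \<in> V"
          using k D_refl closed[OF g] carrier by (simp add: V_iff)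
        moreover have "((m, \<phi> g x), (m, \<phi> g y)) \<in> V ^^ K"
          using level[OF D] True by (simp add: min_def)
        ultimately show ?thesis
          by (metis relpow_Suc_I)
      next
        case False
        have "((m, \<phi> g x), (n, \<phi> g x)) \<in> V"
          using k D_refl closed[OF g] carrier by (simp add: V_iff)
        moreover have "((n, \<phi> g x), (n, \<phi> g y)) \<in> V ^^ K"
          using level[OF D] False by (simp add: min_def)
        ultimately show ?thesis
          by (metis relpow_Suc_I2)
      qed
      then show ?thesis
        using carrier by (simp add: cone_action_def)
    qed
    then have "map_prod (cone_action X \<phi> g) (cone_action X \<phi> g) ` V \<subseteq> V ^^ Suc K"
      by auto
    then show ?thesis ..
  qed
  ultimately have "V \<in> Lipschitz_entourages G X \<phi>"
    by (simp add: Lipschitz_entourages_def coarse_ents_cone[OF X])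
  moreover have "E \<subseteq> V"
  proof (rule subrelI)
    fix p q
    assume pq: "(p, q) \<in> E"
    obtain m x n y where p: "p = (m, x)" "q = (n, y)"
      by (metis surj_pair)
    have near: "\<bar>m - n\<bar> \<le> int k" "(x, y) \<in> U"
      using E_near pq by (auto simp: p)
    \<comment> \<open>At low levels the coarse bound \<open>U\<close> of \<open>E\<close> is
      contained in \<open>R\<close>; further out the pair was recorded in \<open>S\<close>, which
      \<open>L\<close> dominates.\<close>
    have "(x, y) \<in> D (min m n)"
    proof (cases "min m n < int n1")
      case True
      then show ?thesis
        using near(2) R0(3) by (auto simp: D_def R_def)
    next
      case False
      then have "m \<ge> int (nat (min m n))" "n \<ge> int (nat (min m n))"
        by auto
      then have "(x, y) \<in> S (nat (min m n))"
        using pq unfolding S_def p by blast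
      then have "(x, y) \<in> L (nat (min m n)) \<union> (L (nat (min m n)))\<inverse>"
        using SL by blast
      then show ?thesis
        using False by (simp only: D_def if_False)
    qed
    then show "(p, q) \<in> V"
      using near by (simp add: p V_iff)
  qed
  ultimately show ?thesis
    by blast
qed

theorem proposition5p15:
  fixes G :: "('g, 'k) monoid_scheme"
    and X :: "('a, 'm) ubc_space_scheme"
    and \<phi> :: "'g \<Rightarrow> 'a \<Rightarrow> 'a"
  assumes "group G"
    and "uniform_bornological_coarse_space X"
    and "acts_by_ubc_automorphisms G X \<phi>"
    and "countable (carrier G)"
    and "uniformly_free G X \<phi>"
    and "\<exists>U. uniform_scale X U"
    and "G_bornological_coarse_space G X \<phi>"
    and "Lipschitz_action G X \<phi>"
  shows "\<exists>\<V>. \<V> \<subseteq> coarse_ents (cone X) \<and>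
    (\<forall>U\<in>coarse_ents (cone X). \<exists>V\<in>\<V>. U \<subseteq> V) \<and>
    (\<forall>V\<in>\<V>.
       acts_by_bc_automorphisms G (with_generator (cone X) V) (cone_action X \<phi>) \<and>
       branched_coarse_covering G
         (semidirect_quotient G (with_generator (cone X) V) (cone_action X \<phi>))
         (diagonal_action G (with_generator (cone X) V) (cone_action X \<phi>))
         (coarse_quotient G (with_generator (cone X) V) (cone_action X \<phi>))
         (cone_big_family X)
         (\<lambda>(g, n, x). (n, \<phi> (inv\<^bsub>G\<^esub> g) x)))"
proof (intro exI conjI ballI)
  show "Lipschitz_entourages G X \<phi> \<subseteq> coarse_ents (cone X)"
    by (auto simp: Lipschitz_entourages_def)
  show "\<exists>V\<in>Lipschitz_entourages G X \<phi>. U \<subseteq> V" if "U \<in> coarse_ents (cone X)" for U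
    using cofinal_Lipschitz_entourage[OF assms(2,7,6,8) that] .
qed (fact branched_coarse_covering_cone[OF assms(1-5)])+

end
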